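(* Let $q\ge 2$, let $m_0,k_0>0$ be real numbers, and for $i,j\in\{1,\dots,q\}$ let $m_{ij}=m_{ji}\ge 0$, $b_{ij}=b_{ji}\ge 0$, $k_{ij}=k_{ji}\ge 0$ be real numbers with $m_{ii}=b_{ii}=k_{ii}=0$. Consider the coupled harmonic oscillators with $x_1,\dots,x_q\in\mathbb{R}$, $$m_0\ddot x_i+k_0x_i+\sum_{j=1}^{q}m_{ij}(\ddot x_i-\ddot x_j)+\sum_{j=1}^{q}b_{ij}(\dot x_i-\dot x_j)+\sum_{j=1}^{q}k_{ij}(x_i-x_j)=0,\qquad i=1,\dots,q.$$ Let $M=\mathrm{lap}\,(m_{ij})_{i,j=1}^q$, $B=\mathrm{lap}\,(b_{ij})_{i,j=1}^q$, $K=\mathrm{lap}\,(k_{ij})_{i,j=1}^q$ be the associated Laplacian matrices, and define the complex matrix $$\Lambda:=(M+m_0I)^{-1/2}\bigl(B+\mathrm{j}(K+k_0I)\bigr)(M+m_0I)^{-1/2}-\mathrm{j}\frac{k_0}{m_0}I\in\mathbb{C}^{q\times q},$$ where $\mathrm{j}$ is the imaginary unit. Then the oscillators synchronize if and only if $\mathrm{Re}\,\lambda_2(\Lambda)>0$.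
   Context: For a real symmetric array $(a_{ij})_{i,j=1}^q$ with $a_{ij}\ge 0$ and $a_{ii}=0$, the Laplacian $\mathrm{lap}\,(a_{ij})_{i,j=1}^q$ is the $q\times q$ matrix whose $i$th diagonal entry is $\sum_j a_{ij}$ and whose $(i,j)$ entry for $i\ne j$ is $-a_{ij}$. $I$ is the $q\times q$ identity matrix. Since $M$ is symmetric positive semidefinite, $M+m_0I$ is symmetric positive definite, and $(M+m_0I)^{-1/2}$ denotes the inverse of its symmetric positive definite square root. For $A\in\mathbb{C}^{q\times q}$, $\lambda_i(A)$ denotes the $i$th eigenvalue of $A$ (counted with multiplicity) with respect to the ordering $\mathrm{Re}\,\lambda_1(A)\le\mathrm{Re}\,\lambda_2(A)\le\cdots\le\mathrm{Re}\,\lambda_q(A)$. The oscillators are said to synchronize if, for all initial conditions, the solutions satisfy $|x_i(t)-x_j(t)|\to 0$ as $t\to\infty$ for all pairs $(i,j)$. *)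

theory Defs
  imports
    Complex_Main
    "Jordan_Normal_Form.Char_Poly"
    "Jordan_Normal_Form.Gauss_Jordan_Elimination"
begin

text \<open>Indices run over \<open>0, \<dots>, q - 1\<close>, as usual for the matrices of this library, instead of
  \<open>1, \<dots>, q\<close>.\<close>

definition lap :: "nat \<Rightarrow> (nat \<Rightarrow> nat \<Rightarrow> real) \<Rightarrow> real mat" where
  "lap q a = mat q q (\<lambda>(i, j). if i = j then (\<Sum>l<q. a i l) else - a i j)"

definition coupling_array :: "nat \<Rightarrow> (nat \<Rightarrow> nat \<Rightarrow> real) \<Rightarrow> bool" where
  "coupling_array q a \<longleftrightarrow>
     (\<forall>i<q. \<forall>j<q. a i j = a j i \<and> 0 \<le> a i j) \<and> (\<forall>i<q. a i i = 0)"

definition sym_pos_def :: "nat \<Rightarrow> real mat \<Rightarrow> bool" where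
  "sym_pos_def n S \<longleftrightarrow> S \<in> carrier_mat n n \<and> transpose_mat S = S \<and>
     (\<forall>v \<in> carrier_vec n. v \<noteq> 0\<^sub>v n \<longrightarrow> 0 < v \<bullet> (S *\<^sub>v v))"

definition spd_sqrt :: "real mat \<Rightarrow> real mat" where
  "spd_sqrt A = (THE S. sym_pos_def (dim_row A) S \<and> S * S = A)"

text \<open>This is \<open>A\<^sup>-\<^sup>1\<^sup>/\<^sup>2\<close>. For a symmetric positive definite \<open>A\<close> the square root exists, is unique
  and is invertible, so neither \<open>THE\<close> nor \<open>the\<close> is applied outside its intended domain.\<close>

definition spd_inv_sqrt :: "real mat \<Rightarrow> real mat" where
  "spd_inv_sqrt A = the (mat_inverse (spd_sqrt A))"

text \<open>The eigenvalues listed with algebraic multiplicity, ordered by real part. The order among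
  eigenvalues with the same real part is left open; the list of real parts does not depend on it.\<close>

definition eigenvalues_by_Re :: "complex mat \<Rightarrow> complex list" where
  "eigenvalues_by_Re A =
     (SOME es. char_poly A = (\<Prod>e\<leftarrow>es. [:- e, 1:]) \<and> sorted (map Re es))"

text \<open>Here the index \<open>i\<close> counts from 1.\<close>

definition nth_eigenvalue :: "nat \<Rightarrow> complex mat \<Rightarrow> complex" where
  "nth_eigenvalue i A = eigenvalues_by_Re A ! (i - 1)"

definition Lambda_mat ::
  "nat \<Rightarrow> real \<Rightarrow> real \<Rightarrow> (nat \<Rightarrow> nat \<Rightarrow> real) \<Rightarrow> (nat \<Rightarrow> nat \<Rightarrow> real) \<Rightarrow> (nat \<Rightarrow> nat \<Rightarrow> real)
    \<Rightarrow> complex mat" where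
  "Lambda_mat q m0 k0 m b k =
     (let M = lap q m; B = lap q b; K = lap q k;
          R = map_mat complex_of_real (spd_inv_sqrt (M + m0 \<cdot>\<^sub>m 1\<^sub>m q))
      in R * (map_mat complex_of_real B
               + \<i> \<cdot>\<^sub>m map_mat complex_of_real (K + k0 \<cdot>\<^sub>m 1\<^sub>m q)) * R
         - (\<i> * complex_of_real (k0 / m0)) \<cdot>\<^sub>m 1\<^sub>m q)"

text \<open>A trajectory \<open>x\<close> on \<open>[0, \<infinity>)\<close>; \<open>v\<close> and \<open>w\<close> are its velocity and acceleration, with one-sided
  derivatives at time 0.\<close>

definition oscillator_solution ::
  "nat \<Rightarrow> real \<Rightarrow> real \<Rightarrow> (nat \<Rightarrow> nat \<Rightarrow> real) \<Rightarrow> (nat \<Rightarrow> nat \<Rightarrow> real) \<Rightarrow> (nat \<Rightarrow> nat \<Rightarrow> real)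
    \<Rightarrow> (nat \<Rightarrow> real \<Rightarrow> real) \<Rightarrow> bool" where
  "oscillator_solution q m0 k0 m b k x \<longleftrightarrow>
     (\<exists>v w. \<forall>i<q. \<forall>t\<ge>0.
        (x i has_real_derivative v i t) (at t within {0..}) \<and>
        (v i has_real_derivative w i t) (at t within {0..}) \<and>
        m0 * w i t + k0 * x i t
          + (\<Sum>j<q. m i j * (w i t - w j t))
          + (\<Sum>j<q. b i j * (v i t - v j t))
          + (\<Sum>j<q. k i j * (x i t - x j t)) = 0)"

text \<open>Ranging over all initial conditions and their solutions is ranging over all solutions.\<close>

definition oscillators_synchronize ::
  "nat \<Rightarrow> real \<Rightarrow> real \<Rightarrow> (nat \<Rightarrow> nat \<Rightarrow> real) \<Rightarrow> (nat \<Rightarrow> nat \<Rightarrow> real) \<Rightarrow> (nat \<Rightarrow> nat \<Rightarrow> real)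
    \<Rightarrow> bool" where
  "oscillators_synchronize q m0 k0 m b k \<longleftrightarrow>
     (\<forall>x. oscillator_solution q m0 k0 m b k x \<longrightarrow>
        (\<forall>i<q. \<forall>j<q. ((\<lambda>t. \<bar>x i t - x j t\<bar>) \<longlongrightarrow> 0) at_top))"

end

theory Submission
  imports Defs
begin

text \<open>
  Write \<open>N = M + m\<^sub>0 I\<close>, \<open>L = K + k\<^sub>0 I\<close> and \<open>R = N\<^bsup>-1/2\<^esup>\<close>. In the coordinates
  \<open>\<xi> = N\<^bsup>1/2\<^esup> x\<close> the equations of motion become \<open>\<xi>'' + P \<xi>' + H \<xi> = 0\<close> with the symmetric
  matrices \<open>P = R B R\<close> (positive semidefinite) and \<open>H = R L R\<close> (positive definite), and
  \<open>\<Lambda> = P + \<i> (H - (k\<^sub>0/m\<^sub>0) I)\<close>. The vector \<open>1\<close> of ones satisfies \<open>P 1 = 0\<close> and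
  \<open>H 1 = (k\<^sub>0/m\<^sub>0) 1\<close>, so that \<open>\<Lambda> 1 = 0\<close>. Both sides of the theorem say that no
  \<^emph>\<open>undamped mode\<close> exists, that is, no \<open>w \<noteq> 0\<close> orthogonal to \<open>1\<close> with
  \<open>P w = 0\<close> and \<open>H w = \<mu> w\<close>.

  Spectrum. If \<open>\<Lambda> w = z w\<close> with \<open>w = x + \<i> y\<close>, the real part of \<open>w\<^sup>* \<Lambda> w\<close> gives
  \<open>Re z (|x|\<^sup>2 + |y|\<^sup>2) = x \<bullet> P x + y \<bullet> P y\<close>. Hence all eigenvalues have nonnegative real part, and
  \<open>Re z = 0\<close> forces \<open>P x = P y = 0\<close>, \<open>H x = \<mu> x\<close> and \<open>H y = \<mu> y\<close> for a real \<open>\<mu>\<close>. Eigenvalues are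
  counted with algebraic multiplicity, so one copy of the eigenvalue \<open>0\<close> belonging to \<open>1\<close> has to be
  removed from the characteristic polynomial. This is done by deflation: the quotient of \<open>\<Lambda>\<close> by the
  line of \<open>1\<close> has the remaining eigenvalues, and each of them has an eigenvector of \<open>\<Lambda>\<close> orthogonal
  to \<open>1\<close> because the columns of \<open>\<Lambda>\<close> also sum to zero (\<open>deflate_eigenvalue_iff\<close>).

  Dynamics. An undamped mode gives the solution \<open>x(t) = cos (t \<surd>\<mu>) R w\<close>, which never synchronizes.
  For the converse, the energy \<open>x' \<bullet> N x' + x \<bullet> L x\<close> decreases at rate \<open>2 x' \<bullet> B x'\<close>; it keeps the
  trajectory and its derivatives bounded, and Barbalat's lemma turns the convergence of the energy
  into \<open>B x' \<rightarrow> 0\<close>. Differentiating the equation of motion and applying Barbalat's lemma again and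
  again yields \<open>P H\<^sup>j \<xi>' \<rightarrow> 0\<close> and \<open>P H\<^bsup>j+1\<^esup> \<xi> \<rightarrow> 0\<close> for all \<open>j\<close>
  (\<open>krylov_orbit_decays\<close>). If some nonzero vector orthogonal to \<open>1\<close> were annihilated by all
  \<open>P H\<^bsup>j+1\<^esup>\<close>, its Krylov space would contain an eigenvector of \<open>H\<close>, which would be an undamped mode
  (\<open>krylov_orbit_separates\<close>). So without undamped modes these finitely many functionals determine
  the component of \<open>\<xi>\<close> orthogonal to \<open>1\<close>, which therefore tends to zero.

  The same Krylov argument (\<open>krylov_eigenvector\<close>) provides the orthonormal eigenbasis from which
  existence and uniqueness of the positive definite square root follow.
\<close>

section \<open>Symmetric matrices and their square roots\<close>

lemma symmetric_mat_adjoint: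
  fixes A :: "real mat"
  assumes "A \<in> carrier_mat n n" "transpose_mat A = A" "u \<in> carrier_vec n" "v \<in> carrier_vec n"
  shows "(A *\<^sub>v u) \<bullet> v = u \<bullet> (A *\<^sub>v v)"
  using transpose_vec_mult_scalar[of A n n v u] assms by simp

lemma scalar_prod_self_nonneg: "0 \<le> (v :: real vec) \<bullet> v"
  by (auto simp: scalar_prod_def intro: sum_nonneg)

lemma scalar_prod_self_eq_0:
  assumes "(v :: real vec) \<in> carrier_vec n"
  shows "v \<bullet> v = 0 \<longleftrightarrow> v = 0\<^sub>v n"
proof
  assume "v \<bullet> v = 0"
  then have "\<forall>i\<in>{0..<n}. v $ i * v $ i = 0"
    using assms by (subst sum_nonneg_eq_0_iff[symmetric]) (auto simp: scalar_prod_def)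
  then show "v = 0\<^sub>v n" using assms by (intro eq_vecI) auto
qed (use assms in auto)

lemma scalar_prod_self_pos:
  assumes "(v :: real vec) \<in> carrier_vec n" "v \<noteq> 0\<^sub>v n"
  shows "0 < v \<bullet> v"
  using scalar_prod_self_eq_0[OF assms(1)] scalar_prod_self_nonneg[of v] assms(2) by linarith

text \<open>Filling up with zero rows gives a singular square matrix.\<close>
lemma wide_mat_kernel_nonzero:
  fixes K :: "'a :: idom mat"
  assumes K: "K \<in> carrier_mat nr nc" and less: "nr < nc"
  shows "\<exists>v \<in> carrier_vec nc. v \<noteq> 0\<^sub>v nc \<and> K *\<^sub>v v = 0\<^sub>v nr"
proof -
  define M where "M = mat nc nc (\<lambda>(i, j). if i < nr then K $$ (i, j) else 0)"
  have M: "M \<in> carrier_mat nc nc" by (simp add: M_def)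
  have "transpose_mat M *\<^sub>v unit_vec nc nr = 0\<^sub>v nc"
    using less by (intro eq_vecI) (auto simp: M_def)
  moreover have "unit_vec nc nr \<noteq> (0\<^sub>v nc :: 'a vec)"
    using less by simp
  ultimately have "det (transpose_mat M) = 0"
    using M by (subst det_0_iff_vec_prod_zero[of _ nc]) (auto intro!: exI[of _ "unit_vec nc nr"])
  then have "det M = 0" using M by (simp add: det_transpose)
  then obtain v where v: "v \<in> carrier_vec nc" "v \<noteq> 0\<^sub>v nc" "M *\<^sub>v v = 0\<^sub>v nc"
    using det_0_iff_vec_prod_zero[OF M] by auto
  have "K *\<^sub>v v = 0\<^sub>v nr"
  proof (rule eq_vecI)
    fix i assume "i < dim_vec (0\<^sub>v nr :: 'a vec)"
    then have i: "i < nr" by simp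
    have "row K i = row M i" using K i less by (intro eq_vecI) (auto simp: M_def)
    moreover have "(M *\<^sub>v v) $ i = 0" using v(3) i less by simp
    ultimately show "(K *\<^sub>v v) $ i = 0\<^sub>v nr $ i" using K M i less by simp
  qed (use K in auto)
  with v show ?thesis by auto
qed

lemma pow_mat_Suc_vec:
  assumes "A \<in> carrier_mat n n" "c \<in> carrier_vec n"
  shows "(A ^\<^sub>m Suc j) *\<^sub>v c = A *\<^sub>v ((A ^\<^sub>m j) *\<^sub>v c)"
  using assms
proof (induction j arbitrary: c)
  case 0
  then show ?case by simp
next
  case (Suc j)
  have Aj: "A ^\<^sub>m j \<in> carrier_mat n n" "A ^\<^sub>m Suc j \<in> carrier_mat n n" using Suc.prems(1) 
    by (auto intro!: pow_carrier_mat simp del: pow_mat.simps)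
  have Ac: "A *\<^sub>v c \<in> carrier_vec n" using Suc.prems by simp
  have "(A ^\<^sub>m Suc (Suc j)) *\<^sub>v c = (A ^\<^sub>m Suc j) *\<^sub>v (A *\<^sub>v c)"
    using Suc.prems Aj by (subst pow_mat.simps, subst assoc_mult_mat_vec[of _ n n _ n]) auto
  also have "\<dots> = A *\<^sub>v ((A ^\<^sub>m j) *\<^sub>v (A *\<^sub>v c))" using Suc Ac by blast
  also have "(A ^\<^sub>m j) *\<^sub>v (A *\<^sub>v c) = (A ^\<^sub>m Suc j) *\<^sub>v c"
    using assoc_mult_mat_vec[OF Aj(1) Suc.prems] by simp
  finally show ?case .
qed

text \<open>
  The span of \<open>c, A c, A\<^sup>2 c, \<dots>\<close> contains a real eigenvector of a symmetric \<open>A\<close>. The vectors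
  \<open>c, \<dots>, A\<^sup>n c\<close> are linearly dependent, so there is a nonzero complex polynomial \<open>f\<close> of least degree
  with \<open>f(A) c = 0\<close>; if \<open>f = (X - \<mu>) g\<close>, then \<open>g(A) c\<close> is a complex eigenvector for \<open>\<mu>\<close>. Symmetry
  makes \<open>\<mu>\<close> real, and the real or the imaginary part of \<open>g(A) c\<close> is the eigenvector \<open>w\<close>. The
  expansion of \<open>w\<close> is stated through the products \<open>u \<bullet> w\<close> because this is how linear conditions on
  the Krylov space are transferred to \<open>w\<close>.
\<close>
lemma krylov_eigenvector:
  fixes A :: "real mat"
  assumes A: "A \<in> carrier_mat n n" and sym: "transpose_mat A = A"
    and c: "c \<in> carrier_vec n" and c0: "c \<noteq> 0\<^sub>v n"
  shows "\<exists>w \<mu> g. w \<in> carrier_vec n \<and> w \<noteq> 0\<^sub>v n \<and> A *\<^sub>v w = \<mu> \<cdot>\<^sub>v w \<and>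
           (\<forall>u \<in> carrier_vec n. u \<bullet> w = (\<Sum>j<n. g j * (u \<bullet> ((A ^\<^sub>m j) *\<^sub>v c))))"
proof -
  define kr where "kr j = (A ^\<^sub>m j) *\<^sub>v c" for j
  have kr: "kr j \<in> carrier_vec n" for j
    unfolding kr_def using pow_carrier_mat[OF A] c by (rule mult_mat_vec_carrier)
  have kr_Suc: "kr (Suc j) = A *\<^sub>v kr j" for j
    unfolding kr_def using A c by (rule pow_mat_Suc_vec)
  have kr_0: "kr 0 = c" using A c by (simp add: kr_def)
  define Q :: "complex poly \<Rightarrow> bool" where
    "Q f \<longleftrightarrow> f \<noteq> 0 \<and> degree f \<le> n \<and> (\<forall>i<n. (\<Sum>j\<le>n. coeff f j * of_real (kr j $ i)) = 0)" for f
  have "\<exists>f. Q f"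
  proof -
    define Kr where "Kr = mat n (Suc n) (\<lambda>(i, j). kr j $ i)"
    have Kr: "Kr \<in> carrier_mat n (Suc n)" by (simp add: Kr_def)
    obtain v where v: "v \<in> carrier_vec (Suc n)" "v \<noteq> 0\<^sub>v (Suc n)" "Kr *\<^sub>v v = 0\<^sub>v n"
      using wide_mat_kernel_nonzero[OF Kr] by auto
    define f where "f = Poly (map (\<lambda>j. complex_of_real (v $ j)) [0..<Suc n])"
    have cf: "coeff f j = (if j \<le> n then of_real (v $ j) else 0)" for j
      unfolding f_def coeff_Poly_eq nth_default_def by (auto simp del: upt_Suc)
    have "f \<noteq> 0"
    proof
      assume "f = 0"
      then have "v $ j = 0" if "j \<le> n" for j using cf[of j] that by simp
      then have "v = 0\<^sub>v (Suc n)" using v(1) by (intro eq_vecI) auto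
      with v(2) show False by simp
    qed
    moreover have "degree f \<le> n" by (rule degree_le) (simp add: cf)
    moreover have "(\<Sum>j\<le>n. coeff f j * of_real (kr j $ i)) = 0" if i: "i < n" for i
    proof -
      have "(\<Sum>j\<le>n. coeff f j * complex_of_real (kr j $ i)) = of_real (\<Sum>j\<le>n. v $ j * kr j $ i)"
        by (simp add: cf)
      also have "(\<Sum>j\<le>n. v $ j * kr j $ i) = (Kr *\<^sub>v v) $ i"
        using i v(1) Kr by (auto simp: scalar_prod_def Kr_def mult.commute lessThan_Suc_atMost
            atLeast0LessThan intro!: sum.cong)
      finally show ?thesis using v(3) i by simp
    qed
    ultimately show ?thesis unfolding Q_def by blast
  qed
  then obtain f where f: "Q f" and fmin: "\<And>g. Q g \<Longrightarrow> degree f \<le> degree g"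
    using ex_has_least_nat[of Q _ degree] by blast
  \<comment> \<open>A constant annihilating polynomial would give \<open>c = 0\<close>.\<close>
  have "degree f \<noteq> 0"
  proof
    assume "degree f = 0"
    then obtain a where a: "f = [:a:]" by (rule degree_eq_zeroE)
    with f have "a \<noteq> 0" by (simp add: Q_def)
    have "c $ i = 0" if "i < n" for i
    proof -
      have "(\<Sum>j\<le>n. coeff f j * complex_of_real (kr j $ i)) = (\<Sum>j\<in>{0}. coeff f j * of_real (kr j $ i))"
        by (rule sum.mono_neutral_right) (auto simp: a coeff_pCons split: nat.splits)
      then have "a * complex_of_real (kr 0 $ i) = 0" using f that by (simp add: Q_def a)
      with \<open>a \<noteq> 0\<close> show ?thesis by (simp add: kr_0)
    qed
    then have "c = 0\<^sub>v n" using c by (intro eq_vecI) auto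
    with c0 show False by simp
  qed
  then obtain \<mu> where "poly f \<mu> = 0"
    using fundamental_theorem_of_algebra[of f] by (auto simp: constant_degree)
  then obtain g where g: "f = [:- \<mu>, 1:] * g" using poly_eq_0_iff_dvd by (metis dvd_def)
  have "f \<noteq> 0" "degree f \<le> n" using f by (auto simp: Q_def)
  then have "g \<noteq> 0" using g by auto
  then have degg: "degree f = Suc (degree g)"
    unfolding g by (subst degree_mult_eq) auto
  with \<open>degree f \<le> n\<close> have gn: "degree g < n" by simp
  define G where "G i = (\<Sum>j<n. coeff g j * complex_of_real (kr j $ i))" for i
  have Geq: "G i = (\<Sum>j\<le>n. coeff g j * complex_of_real (kr j $ i))" for i
    unfolding G_def lessThan_Suc_atMost[symmetric] using gn by (simp add: coeff_eq_0)
  have Gne: "\<exists>i<n. G i \<noteq> 0"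
  proof (rule ccontr)
    assume "\<not> ?thesis"
    then have "Q g" unfolding Q_def using \<open>g \<noteq> 0\<close> gn by (auto simp: Geq)
    from fmin[OF this] degg show False by simp
  qed
  have cf0: "coeff f 0 = - \<mu> * coeff g 0" unfolding g by simp
  have cfS: "coeff f (Suc j) = coeff g j - \<mu> * coeff g (Suc j)" for j unfolding g by simp
  \<comment> \<open>\<open>(A - \<mu>) g(A) c = f(A) c = 0\<close>, one component at a time.\<close>
  have AG: "(\<Sum>l<n. complex_of_real (A $$ (i, l)) * G l) = \<mu> * G i" if i: "i < n" for i
  proof -
    have "(\<Sum>l<n. complex_of_real (A $$ (i, l)) * G l)
        = (\<Sum>j<n. coeff g j * of_real (\<Sum>l<n. A $$ (i, l) * kr j $ l))"
      unfolding G_def sum_distrib_left of_real_sum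
      by (subst sum.swap) (simp add: sum_distrib_left mult_ac)
    also have "\<dots> = (\<Sum>j<n. coeff g j * of_real (kr (Suc j) $ i))"
    proof -
      have "(\<Sum>l<n. A $$ (i, l) * kr j $ l) = kr (Suc j) $ i" for j
        using A i carrier_vecD[OF kr, of j] unfolding kr_Suc
        by (simp add: scalar_prod_def atLeast0LessThan)
      then show ?thesis by simp
    qed
    also have "\<dots> = (\<Sum>j\<le>n. coeff f j * of_real (kr j $ i)) + \<mu> * G i"
      unfolding Geq lessThan_Suc_atMost[symmetric] sum.lessThan_Suc_shift cf0 cfS
      by (simp add: sum_distrib_left algebra_simps sum.distrib sum_subtractf)
    also have "\<dots> = \<mu> * G i" using f i by (simp add: Q_def)
    finally show ?thesis .
  qed
  define a where "a = vec n (\<lambda>i. Re (G i))"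
  define b where "b = vec n (\<lambda>i. Im (G i))"
  have ab: "a \<in> carrier_vec n" "b \<in> carrier_vec n" by (auto simp: a_def b_def)
  have Aa: "A *\<^sub>v a = Re \<mu> \<cdot>\<^sub>v a - Im \<mu> \<cdot>\<^sub>v b"
  proof (rule eq_vecI)
    fix i assume "i < dim_vec (Re \<mu> \<cdot>\<^sub>v a - Im \<mu> \<cdot>\<^sub>v b)"
    then have i: "i < n" by (simp add: b_def)
    show "(A *\<^sub>v a) $ i = (Re \<mu> \<cdot>\<^sub>v a - Im \<mu> \<cdot>\<^sub>v b) $ i"
      using arg_cong[OF AG[OF i], of Re] A i
      by (simp add: a_def b_def scalar_prod_def atLeast0LessThan)
  qed (use A in \<open>auto simp: b_def\<close>)
  have Ab: "A *\<^sub>v b = Im \<mu> \<cdot>\<^sub>v a + Re \<mu> \<cdot>\<^sub>v b"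
  proof (rule eq_vecI)
    fix i assume "i < dim_vec (Im \<mu> \<cdot>\<^sub>v a + Re \<mu> \<cdot>\<^sub>v b)"
    then have i: "i < n" by (simp add: b_def)
    show "(A *\<^sub>v b) $ i = (Im \<mu> \<cdot>\<^sub>v a + Re \<mu> \<cdot>\<^sub>v b) $ i"
      using arg_cong[OF AG[OF i], of Im] A i
      by (simp add: a_def b_def scalar_prod_def atLeast0LessThan)
  qed (use A in \<open>auto simp: b_def\<close>)
  have ne: "a \<noteq> 0\<^sub>v n \<or> b \<noteq> 0\<^sub>v n"
  proof (rule ccontr)
    assume "\<not> ?thesis"
    then have "a $ i = 0 \<and> b $ i = 0" if "i < n" for i using that by simp
    then have "G i = 0" if "i < n" for i using that by (simp add: a_def b_def complex_eq_iff)
    with Gne show False by auto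
  qed
  \<comment> \<open>\<open>A a \<bullet> b = a \<bullet> A b\<close> becomes \<open>Im \<mu> (a \<bullet> a + b \<bullet> b) = 0\<close>.\<close>
  have "Im \<mu> = 0"
  proof -
    have "(A *\<^sub>v a) \<bullet> b = a \<bullet> (A *\<^sub>v b)" by (rule symmetric_mat_adjoint[OF A sym ab])
    then have "Im \<mu> * (a \<bullet> a + b \<bullet> b) = 0"
      unfolding Aa Ab using ab
      by (simp add: minus_scalar_prod_distrib[of _ n] scalar_prod_add_distrib[of _ n] algebra_simps)
    moreover have "a \<bullet> a + b \<bullet> b \<noteq> 0"
      using ne ab scalar_prod_self_nonneg[of a] scalar_prod_self_nonneg[of b]
        scalar_prod_self_pos[of a n] scalar_prod_self_pos[of b n] by force
    ultimately show ?thesis by simp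
  qed
  then have eig: "A *\<^sub>v a = Re \<mu> \<cdot>\<^sub>v a" "A *\<^sub>v b = Re \<mu> \<cdot>\<^sub>v b"
    unfolding Aa Ab using ab by auto
  have comb: "u \<bullet> vec n (\<lambda>i. \<Sum>j<n. h j * kr j $ i) = (\<Sum>j<n. h j * (u \<bullet> kr j))"
    if "u \<in> carrier_vec n" for u h
    using that unfolding scalar_prod_def
    by (simp add: carrier_vecD[OF kr] sum_distrib_left mult_ac atLeast0LessThan) (rule sum.swap)
  have a': "a = vec n (\<lambda>i. \<Sum>j<n. Re (coeff g j) * kr j $ i)"
   and b': "b = vec n (\<lambda>i. \<Sum>j<n. Im (coeff g j) * kr j $ i)"
    by (auto simp: a_def b_def G_def)
  have "\<exists>w g. w \<in> carrier_vec n \<and> w \<noteq> 0\<^sub>v n \<and> A *\<^sub>v w = Re \<mu> \<cdot>\<^sub>v w \<and>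
          w = vec n (\<lambda>i. \<Sum>j<n. g j * kr j $ i)"
    using ne
  proof
    assume "a \<noteq> 0\<^sub>v n"
    then show ?thesis using eig(1) ab(1) a' by (intro exI[of _ a] exI[of _ "\<lambda>j. Re (coeff g j)"]) simp
  next
    assume "b \<noteq> 0\<^sub>v n"
    then show ?thesis using eig(2) ab(2) b' by (intro exI[of _ b] exI[of _ "\<lambda>j. Im (coeff g j)"]) simp
  qed
  then obtain w h where w: "w \<in> carrier_vec n" "w \<noteq> 0\<^sub>v n" "A *\<^sub>v w = Re \<mu> \<cdot>\<^sub>v w"
    and wh: "w = vec n (\<lambda>i. \<Sum>j<n. h j * kr j $ i)"
    by blast
  have "\<forall>u \<in> carrier_vec n. u \<bullet> w = (\<Sum>j<n. h j * (u \<bullet> ((A ^\<^sub>m j) *\<^sub>v c)))"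
    using comb unfolding wh kr_def by simp
  with w show ?thesis by (intro exI[of _ w] exI[of _ "Re \<mu>"] exI[of _ h] conjI)
qed

text \<open>
  The orthogonal complement of eigenvectors is invariant under \<open>A\<close>. So as long as there are fewer
  than \<open>n\<close> of them, the Krylov space of any nonzero vector of the complement supplies a further one.
\<close>
lemma orthonormal_eigenvectors:
  fixes A :: "real mat"
  assumes A: "A \<in> carrier_mat n n" and sym: "transpose_mat A = A" and k: "k \<le> n"
  shows "\<exists>u d. (\<forall>i<k. u i \<in> carrier_vec n \<and> A *\<^sub>v u i = d i \<cdot>\<^sub>v u i) \<and>
           (\<forall>i<k. \<forall>j<k. u i \<bullet> u j = (if i = j then 1 else 0))"
  using k
proof (induction k)
  case 0
  show ?case by simp
next
  case (Suc k)
  then obtain u d where u: "\<And>i. i < k \<Longrightarrow> u i \<in> carrier_vec n"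
    and eig: "\<And>i. i < k \<Longrightarrow> A *\<^sub>v u i = d i \<cdot>\<^sub>v u i"
    and on: "\<And>i j. i < k \<Longrightarrow> j < k \<Longrightarrow> u i \<bullet> u j = (if i = j then 1 else 0)"
    by (metis Suc_leD)
  have "mat k n (\<lambda>(i, j). u i $ j) \<in> carrier_mat k n" by simp
  from wide_mat_kernel_nonzero[OF this] Suc.prems obtain c where
    c: "c \<in> carrier_vec n" "c \<noteq> 0\<^sub>v n" "mat k n (\<lambda>(i, j). u i $ j) *\<^sub>v c = 0\<^sub>v k"
    by auto
  have uc: "u i \<bullet> c = 0" if "i < k" for i
    using arg_cong[OF c(3), of "\<lambda>v. v $ i"] that u[OF that] c(1) by (simp add: scalar_prod_def)
  obtain w \<mu> g where w: "w \<in> carrier_vec n" "w \<noteq> 0\<^sub>v n" and weig: "A *\<^sub>v w = \<mu> \<cdot>\<^sub>v w"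
    and g: "\<And>v. v \<in> carrier_vec n \<Longrightarrow> v \<bullet> w = (\<Sum>j<n. g j * (v \<bullet> ((A ^\<^sub>m j) *\<^sub>v c)))"
    using krylov_eigenvector[OF A sym c(1,2)] by metis
  have uw: "u i \<bullet> w = 0" if i: "i < k" for i
  proof -
    have "u i \<bullet> ((A ^\<^sub>m j) *\<^sub>v c) = 0" for j
    proof (induction j)
      case 0
      then show ?case using uc[OF i] A c by simp
    next
      case (Suc j)
      have Aj: "(A ^\<^sub>m j) *\<^sub>v c \<in> carrier_vec n"
        using pow_carrier_mat[OF A] c(1) by (rule mult_mat_vec_carrier)
      have "u i \<bullet> (A *\<^sub>v ((A ^\<^sub>m j) *\<^sub>v c)) = (A *\<^sub>v u i) \<bullet> ((A ^\<^sub>m j) *\<^sub>v c)"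
        using symmetric_mat_adjoint[OF A sym u[OF i] Aj] by simp
      also have "\<dots> = 0" using eig[OF i] u[OF i] Aj Suc by simp
      finally show ?case using pow_mat_Suc_vec[OF A c(1)] by simp
    qed
    then show ?thesis using g[OF u[OF i]] by simp
  qed
  define s where "s = 1 / sqrt (w \<bullet> w)"
  define z where "z = s \<cdot>\<^sub>v w"
  have ww: "w \<bullet> w > 0" by (rule scalar_prod_self_pos[OF w])
  have z: "z \<in> carrier_vec n" using w by (simp add: z_def)
  have zz: "z \<bullet> z = 1" using w(1) ww by (simp add: z_def s_def)
  have zeig: "A *\<^sub>v z = \<mu> \<cdot>\<^sub>v z"
    unfolding z_def mult_mat_vec[OF A w(1)] weig using w(1) by (simp add: smult_smult_assoc mult.commute)
  have uz: "u i \<bullet> z = 0" "z \<bullet> u i = 0" if "i < k" for i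
    using uw[OF that] u[OF that] w(1) z by (simp_all add: z_def comm_scalar_prod[of w n])
  show ?case
    by (rule exI[of _ "u(k := z)"], rule exI[of _ "d(k := \<mu>)"])
       (auto simp: less_Suc_eq u eig on z zz zeig uz)
qed

lemma sym_pos_def_kernel:
  assumes "sym_pos_def n S" "v \<in> carrier_vec n" "S *\<^sub>v v = 0\<^sub>v n"
  shows "v = 0\<^sub>v n"
  using assms unfolding sym_pos_def_def by (metis less_irrefl scalar_prod_right_zero)

text \<open>
  For \<open>y = S v - s v\<close> one has \<open>(S + s) y = 0\<close>, and \<open>S + s\<close> is positive definite. This determines
  a positive definite square root on every eigenvector of its square: it yields the uniqueness of
  the square root, and later its value on the vector of ones.
\<close>
lemma sym_pos_def_sqrt_eigenvector:
  assumes S: "sym_pos_def n S" and v: "v \<in> carrier_vec n"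
    and eig: "(S * S) *\<^sub>v v = (s * s) \<cdot>\<^sub>v v" and s: "s > 0"
  shows "S *\<^sub>v v = s \<cdot>\<^sub>v v"
proof -
  have Sc: "S \<in> carrier_mat n n" using S by (simp add: sym_pos_def_def)
  define y where "y = S *\<^sub>v v - s \<cdot>\<^sub>v v"
  have y: "y \<in> carrier_vec n" using Sc v by (simp add: y_def)
  have "S *\<^sub>v y = (s * s) \<cdot>\<^sub>v v - s \<cdot>\<^sub>v (S *\<^sub>v v)"
    unfolding y_def using Sc v eig
    by (simp add: mult_minus_distrib_mat_vec[of _ n n] mult_mat_vec[of _ n n] assoc_mult_mat_vec[of _ n n _ n])
  also have "\<dots> = (- s) \<cdot>\<^sub>v y" unfolding y_def using Sc v
    by (intro eq_vecI) (auto simp: algebra_simps)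
  finally have "y \<bullet> (S *\<^sub>v y) = - s * (y \<bullet> y)" using y by simp
  then have "y \<bullet> (S *\<^sub>v y) \<le> 0" using s scalar_prod_self_nonneg[of y] by (simp add: mult_nonneg_nonneg)
  then have "y = 0\<^sub>v n" using S y unfolding sym_pos_def_def by force
  show ?thesis
  proof (rule eq_vecI)
    fix i assume "i < dim_vec (s \<cdot>\<^sub>v v)"
    then have "i < n" using v by simp
    then have "y $ i = 0" using \<open>y = 0\<^sub>v n\<close> by simp
    then show "(S *\<^sub>v v) $ i = (s \<cdot>\<^sub>v v) $ i" using \<open>i < n\<close> v Sc by (simp add: y_def)
  qed (use Sc v in auto)
qed

text \<open>
  With the orthonormal eigenvectors as the columns of \<open>V\<close>, the square root is \<open>V \<surd>D V\<^sup>T\<close>.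
\<close>
lemma ex1_sym_pos_def_sqrt:
  assumes A: "sym_pos_def n A"
  shows "\<exists>!S. sym_pos_def n S \<and> S * S = A"
proof -
  have Ac: "A \<in> carrier_mat n n" and sym: "transpose_mat A = A"
    using A by (auto simp: sym_pos_def_def)
  obtain u d where u: "\<And>i. i < n \<Longrightarrow> u i \<in> carrier_vec n"
    and eig: "\<And>i. i < n \<Longrightarrow> A *\<^sub>v u i = d i \<cdot>\<^sub>v u i"
    and on: "\<And>i j. i < n \<Longrightarrow> j < n \<Longrightarrow> u i \<bullet> u j = (if i = j then 1 else 0)"
    using orthonormal_eigenvectors[OF Ac sym order_refl] by metis
  have d: "d i > 0" if i: "i < n" for i
  proof -
    have "u i \<noteq> 0\<^sub>v n" using on[OF i i] u[OF i] by auto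
    then have "0 < u i \<bullet> (A *\<^sub>v u i)" using A u[OF i] by (simp add: sym_pos_def_def)
    also have "\<dots> = d i" using eig[OF i] on[OF i i] u[OF i] by simp
    finally show ?thesis .
  qed
  define V where "V = mat n n (\<lambda>(i, j). u j $ i)"
  define D where "D = mat_diag n (\<lambda>i. sqrt (d i))"
  define S where "S = V * (D * transpose_mat V)"
  have V: "V \<in> carrier_mat n n" "transpose_mat V \<in> carrier_mat n n" and D: "D \<in> carrier_mat n n"
    by (auto simp: V_def D_def)
  have Sc: "S \<in> carrier_mat n n" using V D by (simp add: S_def)
  have colV: "col V j = u j" if "j < n" for j
    using u[OF that] that by (intro eq_vecI) (auto simp: V_def)
  have VtV: "transpose_mat V * V = 1\<^sub>m n"
    using V by (intro eq_matI) (auto simp: colV on)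
  then have VVt: "V * transpose_mat V = 1\<^sub>m n" using V mat_mult_left_right_inverse by blast
  have SV: "B * V = V * D" if B: "B \<in> carrier_mat n n"
    "\<And>i. i < n \<Longrightarrow> B *\<^sub>v u i = sqrt (d i) \<cdot>\<^sub>v u i" for B
  proof (rule eq_matI)
    fix i j assume "i < dim_row (V * D)" "j < dim_col (V * D)"
    then have ij: "i < n" "j < n" using V D by auto
    have "(B * V) $$ (i, j) = (B *\<^sub>v u j) $ i" using B(1) V ij by (simp add: colV)
    also have "\<dots> = (V * D) $$ (i, j)"
      using B(2)[OF ij(2)] ij u[OF ij(2)] unfolding D_def mat_diag_mult_right[OF V(1)]
      by (simp add: V_def)
    finally show "(B * V) $$ (i, j) = (V * D) $$ (i, j)" .
  qed (use B V D in auto)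
  have uniq: "B = S" if B: "B \<in> carrier_mat n n"
    "\<And>i. i < n \<Longrightarrow> B *\<^sub>v u i = sqrt (d i) \<cdot>\<^sub>v u i" for B
  proof -
    have BV: "B * V = V * D" using B by (rule SV)
    have "B = B * (V * transpose_mat V)" using B(1) VVt by simp
    also have "\<dots> = (B * V) * transpose_mat V" by (rule assoc_mult_mat[OF B(1) V, symmetric])
    also have "\<dots> = S" unfolding BV S_def by (rule assoc_mult_mat[OF V(1) D V(2)])
    finally show ?thesis .
  qed
  have St: "transpose_mat S = S"
  proof -
    have "transpose_mat D = D" by (intro eq_matI) (auto simp: D_def mat_diag_def)
    then show ?thesis unfolding S_def using V D
      by (simp add: transpose_mult[of _ n n _ n] assoc_mult_mat[of _ n n _ n _ n])
  qed
  have "S * S = A"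
  proof -
    have "S * S = V * (D * ((transpose_mat V * V) * (D * transpose_mat V)))"
      unfolding S_def using V D by (simp add: assoc_mult_mat[of _ n n _ n _ n])
    also have "\<dots> = V * ((D * D) * transpose_mat V)"
      unfolding VtV using V D by (simp add: assoc_mult_mat[of _ n n _ n _ n])
    also have "D * D = mat_diag n d" 
      unfolding D_def mat_diag_diag using d by (intro eq_matI) (auto simp: mat_diag_def less_imp_le)
    also have "V * (mat_diag n d * transpose_mat V) = (V * mat_diag n d) * transpose_mat V"
      using V by (simp add: assoc_mult_mat[of _ n n _ n _ n])
    also have "V * mat_diag n d = A * V"
    proof (rule eq_matI)
      fix i j assume "i < dim_row (A * V)" "j < dim_col (A * V)"
      then have ij: "i < n" "j < n" using V Ac by auto
      have "(A * V) $$ (i, j) = (A *\<^sub>v u j) $ i" using Ac V ij by (simp add: colV)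
      then show "(V * mat_diag n d) $$ (i, j) = (A * V) $$ (i, j)"
        using eig[OF ij(2)] ij u[OF ij(2)] unfolding mat_diag_mult_right[OF V(1)]
        by (simp add: V_def)
    qed (use Ac V in \<open>auto simp: mat_diag_def\<close>)
    also have "A * V * transpose_mat V = A"
      using Ac V VVt by (simp add: assoc_mult_mat[of _ n n _ n _ n])
    finally show ?thesis .
  qed
  moreover have "sym_pos_def n S"
    unfolding sym_pos_def_def
  proof (intro conjI ballI impI Sc St)
    fix v :: "real vec" assume v: "v \<in> carrier_vec n" "v \<noteq> 0\<^sub>v n"
    define y where "y = transpose_mat V *\<^sub>v v"
    have y: "y \<in> carrier_vec n" using V v by (simp add: y_def)
    have "V *\<^sub>v y = v" unfolding y_def using V v VVt
      by (simp flip: assoc_mult_mat_vec[of _ n n _ n])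
    then have "y \<noteq> 0\<^sub>v n" using v V by auto
    then obtain i where i: "i < n" "y $ i \<noteq> 0" using y by (metis eq_vecI carrier_vecD index_zero_vec)
    have "v \<bullet> (S *\<^sub>v v) = v \<bullet> (V *\<^sub>v (D *\<^sub>v y))"
      unfolding S_def y_def using V D v by (simp add: assoc_mult_mat_vec[of _ n n _ n])
    also have "\<dots> = y \<bullet> (D *\<^sub>v y)"
      unfolding y_def using V D v by (subst transpose_vec_mult_scalar[of V n n]) auto
    also have "\<dots> = (\<Sum>i<n. sqrt (d i) * (y $ i)\<^sup>2)"
    proof -
      have "(D *\<^sub>v y) $ i = sqrt (d i) * y $ i" if "i < n" for i
        using y that by (simp add: D_def mat_diag_def scalar_prod_def if_distrib[of "\<lambda>x. x * _"] cong: if_cong)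
      then show ?thesis using y D
        by (simp add: scalar_prod_def power2_eq_square atLeast0LessThan mult_ac)
    qed
    also have "\<dots> > 0"
      using i d by (intro sum_pos2[of _ i]) (auto simp: less_imp_le)
    finally show "0 < v \<bullet> (S *\<^sub>v v)" .
  qed
  moreover have "T = S" if T: "sym_pos_def n T \<and> T * T = A" for T
  proof (rule uniq)
    show "T \<in> carrier_mat n n" using T by (simp add: sym_pos_def_def)
    show "T *\<^sub>v u i = sqrt (d i) \<cdot>\<^sub>v u i" if i: "i < n" for i
    proof (rule sym_pos_def_sqrt_eigenvector[of n])
      show "(T * T) *\<^sub>v u i = (sqrt (d i) * sqrt (d i)) \<cdot>\<^sub>v u i"
        using T eig[OF i] less_imp_le[OF d[OF i]] by simp
    qed (use T u[OF i] d[OF i] in auto)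
  qed
  ultimately show ?thesis by (intro ex1I[of _ S] conjI)
qed

lemma spd_sqrt:
  assumes "sym_pos_def n A"
  shows "sym_pos_def n (spd_sqrt A)" "spd_sqrt A * spd_sqrt A = A"
proof -
  have "dim_row A = n" using assms by (auto simp: sym_pos_def_def)
  then have "sym_pos_def n (spd_sqrt A) \<and> spd_sqrt A * spd_sqrt A = A"
    unfolding spd_sqrt_def using theI'[OF ex1_sym_pos_def_sqrt[OF assms]] by simp
  then show "sym_pos_def n (spd_sqrt A)" "spd_sqrt A * spd_sqrt A = A" by auto
qed

lemma nonsingular_mat_inverse:
  fixes A :: "'a :: field mat"
  assumes A: "A \<in> carrier_mat n n" and det: "det A \<noteq> 0"
  shows "\<exists>B \<in> carrier_mat n n. A * B = 1\<^sub>m n \<and> B * A = 1\<^sub>m n \<and> mat_inverse A = Some B"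
proof -
  have "A \<in> Units (ring_mat TYPE('a) n ())" by (rule det_non_zero_imp_unit[OF A det])
  then have "mat_inverse A \<noteq> None"
    using mat_inverse(1)[OF A, of "()"] by (rule contrapos_pn)
  then obtain B where "mat_inverse A = Some B" by blast
  then show ?thesis using mat_inverse(2)[OF A] by blast
qed

lemma spd_inv_sqrt:
  assumes A: "sym_pos_def n A"
  shows "spd_inv_sqrt A \<in> carrier_mat n n" "transpose_mat (spd_inv_sqrt A) = spd_inv_sqrt A"
    "spd_sqrt A * spd_inv_sqrt A = 1\<^sub>m n" "spd_inv_sqrt A * spd_sqrt A = 1\<^sub>m n"
proof -
  let ?T = "spd_sqrt A" and ?R = "spd_inv_sqrt A"
  have T: "?T \<in> carrier_mat n n" "transpose_mat ?T = ?T"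
    using spd_sqrt(1)[OF A] by (auto simp: sym_pos_def_def)
  have "det ?T \<noteq> 0"
    using det_0_iff_vec_prod_zero[OF T(1)] sym_pos_def_kernel[OF spd_sqrt(1)[OF A]] by auto
  then have R: "?R \<in> carrier_mat n n" "?T * ?R = 1\<^sub>m n" "?R * ?T = 1\<^sub>m n"
    using nonsingular_mat_inverse[OF T(1)] by (auto simp: spd_inv_sqrt_def)
  have "transpose_mat ?R * ?T = 1\<^sub>m n"
    using transpose_mult[OF T(1) R(1)] T(2) R(2) by simp
  then have "transpose_mat ?R * (?T * ?R) = ?R"
    using T R(1) by (simp flip: assoc_mult_mat[of _ n n _ n _ n])
  then have "transpose_mat ?R = ?R" using R T by simp
  with R show "?R \<in> carrier_mat n n" "transpose_mat ?R = ?R" "?T * ?R = 1\<^sub>m n" "?R * ?T = 1\<^sub>m n"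
    by auto
qed

lemma symmetric_mat_power_adjoint:
  fixes A :: "real mat"
  assumes A: "A \<in> carrier_mat n n" "transpose_mat A = A" and "u \<in> carrier_vec n" "v \<in> carrier_vec n"
  shows "((A ^\<^sub>m j) *\<^sub>v u) \<bullet> v = u \<bullet> ((A ^\<^sub>m j) *\<^sub>v v)"
  using assms(3,4)
proof (induction j arbitrary: u)
  case 0
  then show ?case using A by simp
next
  case (Suc j)
  have Ajv: "(A ^\<^sub>m j) *\<^sub>v v \<in> carrier_vec n"
    using pow_carrier_mat[OF A(1)] Suc.prems(2) by (rule mult_mat_vec_carrier)
  have Au: "A *\<^sub>v u \<in> carrier_vec n" using A(1) Suc.prems(1) by (rule mult_mat_vec_carrier)
  have "((A ^\<^sub>m Suc j) *\<^sub>v u) \<bullet> v = ((A ^\<^sub>m j) *\<^sub>v (A *\<^sub>v u)) \<bullet> v"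
    using assoc_mult_mat_vec[OF pow_carrier_mat[OF A(1)] A(1) Suc.prems(1)] by simp
  also have "\<dots> = (A *\<^sub>v u) \<bullet> ((A ^\<^sub>m j) *\<^sub>v v)" by (rule Suc.IH[OF Au Suc.prems(2)])
  also have "\<dots> = u \<bullet> (A *\<^sub>v ((A ^\<^sub>m j) *\<^sub>v v))"
    by (rule symmetric_mat_adjoint[OF A Suc.prems(1) Ajv])
  finally show ?case unfolding pow_mat_Suc_vec[OF A(1) Suc.prems(2)] .
qed

text \<open>
  If the functionals in \<open>S\<close> have no common zero except \<open>0\<close>, the Gram matrix
  \<open>G = \<Sum>c\<in>S. c c\<^sup>T\<close> is positive definite. Solving \<open>G y = u\<close> expresses \<open>u\<close> as a linear
  combination of \<open>S\<close>, so that convergence of the functionals in \<open>S\<close> passes to \<open>u\<close>.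
\<close>
lemma separating_functionals_tendsto_0:
  fixes z :: "'t \<Rightarrow> real vec"
  assumes fin: "finite S" and S: "S \<subseteq> carrier_vec n"
    and sep: "\<And>y. y \<in> carrier_vec n \<Longrightarrow> (\<And>c. c \<in> S \<Longrightarrow> c \<bullet> y = 0) \<Longrightarrow> y = 0\<^sub>v n"
    and z: "\<And>t. z t \<in> carrier_vec n"
    and lim: "\<And>c. c \<in> S \<Longrightarrow> ((\<lambda>t. c \<bullet> z t) \<longlongrightarrow> 0) F"
    and u: "u \<in> carrier_vec n"
  shows "((\<lambda>t. u \<bullet> z t) \<longlongrightarrow> 0) F"
proof -
  define G where "G = mat n n (\<lambda>(i, j). \<Sum>c\<in>S. c $ i * c $ j)"
  have G: "G \<in> carrier_mat n n" by (simp add: G_def)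
  have form: "(G *\<^sub>v y) \<bullet> v = (\<Sum>c\<in>S. (c \<bullet> y) * (c \<bullet> v))"
    if y: "y \<in> carrier_vec n" and v: "v \<in> carrier_vec n" for y v
  proof -
    have "(G *\<^sub>v y) \<bullet> v = (\<Sum>i<n. \<Sum>j<n. \<Sum>c\<in>S. c $ i * c $ j * y $ j * v $ i)"
      using y v by (simp add: G_def scalar_prod_def atLeast0LessThan sum_distrib_right)
    also have "\<dots> = (\<Sum>c\<in>S. \<Sum>i<n. \<Sum>j<n. c $ i * c $ j * y $ j * v $ i)"
      by (subst (2) sum.swap) (subst sum.swap, rule refl)
    also have "\<dots> = (\<Sum>c\<in>S. (c \<bullet> y) * (c \<bullet> v))"
      using y v by (intro sum.cong refl, simp add: scalar_prod_def atLeast0LessThan sum_product)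
        (subst sum.swap, simp add: mult_ac)
    finally show ?thesis .
  qed
  have "det G \<noteq> 0"
  proof
    assume "det G = 0"
    then obtain y where y: "y \<in> carrier_vec n" "y \<noteq> 0\<^sub>v n" "G *\<^sub>v y = 0\<^sub>v n"
      using det_0_iff_vec_prod_zero[OF G] by auto
    have "(\<Sum>c\<in>S. (c \<bullet> y) * (c \<bullet> y)) = 0" using form[OF y(1) y(1)] y by simp
    then have "c \<bullet> y = 0" if "c \<in> S" for c
      using that fin by (subst (asm) sum_nonneg_eq_0_iff) auto
    from sep[OF y(1) this] y(2) show False by simp
  qed
  then obtain K where K: "K \<in> carrier_mat n n" "G * K = 1\<^sub>m n"
    using nonsingular_mat_inverse[OF G] by blast
  define y where "y = K *\<^sub>v u"
  have y: "y \<in> carrier_vec n" using K u by (simp add: y_def)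
  have "G *\<^sub>v y = u" unfolding y_def using assoc_mult_mat_vec[OF G K(1) u] K(2) u by simp
  then have "u \<bullet> z t = (\<Sum>c\<in>S. (c \<bullet> y) * (c \<bullet> z t))" for t using form[OF y z] by simp
  moreover have "((\<lambda>t. \<Sum>c\<in>S. (c \<bullet> y) * (c \<bullet> z t)) \<longlongrightarrow> (\<Sum>c\<in>S. (c \<bullet> y) * 0)) F"
    by (intro tendsto_sum tendsto_mult tendsto_const lim)
  ultimately show ?thesis by simp
qed

lemma scalar_prod_eq_sum: "w \<in> carrier_vec n \<Longrightarrow> v \<bullet> w = (\<Sum>i<n. v $ i * w $ i)"
  by (auto simp: scalar_prod_def atLeast0LessThan)

section \<open>Laplacian matrices\<close>

lemma lap_carrier [simp]: "lap q a \<in> carrier_mat q q"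
  by (simp add: lap_def)

lemma lap_dim [simp]: "dim_row (lap q a) = q" "dim_col (lap q a) = q"
  by (simp_all add: lap_def)

lemma transpose_lap: "coupling_array q a \<Longrightarrow> transpose_mat (lap q a) = lap q a"
  by (intro eq_matI) (auto simp: lap_def coupling_array_def)

lemma lap_mult_vec:
  assumes a: "coupling_array q a" and v: "v \<in> carrier_vec q" and i: "i < q"
  shows "(lap q a *\<^sub>v v) $ i = (\<Sum>j<q. a i j * (v $ i - v $ j))"
proof -
  have "(lap q a *\<^sub>v v) $ i = (\<Sum>j<q. (if i = j then (\<Sum>l<q. a i l) else - a i j) * v $ j)"
    using v i by (simp add: lap_def scalar_prod_def atLeast0LessThan)
  also have "\<dots> = (\<Sum>j<q. (if j = i then (\<Sum>l<q. a i l) * v $ i else 0) - a i j * v $ j)"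
    using a i by (intro sum.cong) (auto simp: coupling_array_def)
  also have "\<dots> = (\<Sum>l<q. a i l) * v $ i - (\<Sum>j<q. a i j * v $ j)"
    using i by (simp add: sum_subtractf)
  also have "\<dots> = (\<Sum>j<q. a i j * (v $ i - v $ j))"
    by (simp add: sum_distrib_right sum_subtractf right_diff_distrib)
  finally show ?thesis .
qed

lemma lap_quadratic_form:
  assumes a: "coupling_array q a" and v: "v \<in> carrier_vec q"
  shows "2 * (v \<bullet> (lap q a *\<^sub>v v)) = (\<Sum>i<q. \<Sum>j<q. a i j * (v $ i - v $ j)\<^sup>2)"
proof -
  have eq: "v \<bullet> (lap q a *\<^sub>v v) = (\<Sum>i<q. \<Sum>j<q. a i j * v $ i * (v $ i - v $ j))"
    unfolding scalar_prod_eq_sum[OF mult_mat_vec_carrier[OF lap_carrier v]]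
    by (auto simp: lap_mult_vec[OF a v] sum_distrib_left mult_ac simp del: index_mult_mat_vec
        intro!: sum.cong)
  also have "\<dots> = (\<Sum>i<q. \<Sum>j<q. a i j * v $ j * (v $ j - v $ i))"
    using a by (subst sum.swap) (auto simp: coupling_array_def intro!: sum.cong)
  finally have "2 * (v \<bullet> (lap q a *\<^sub>v v)) = (\<Sum>i<q. \<Sum>j<q. a i j * v $ i * (v $ i - v $ j))
      + (\<Sum>i<q. \<Sum>j<q. a i j * v $ j * (v $ j - v $ i))"
    using eq by simp
  also have "\<dots> = (\<Sum>i<q. \<Sum>j<q. a i j * (v $ i - v $ j)\<^sup>2)"
    by (simp add: sum.distrib[symmetric] algebra_simps power2_eq_square)
  finally show ?thesis .
qed

lemma lap_quadratic_form_nonneg: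
  assumes "coupling_array q a" "v \<in> carrier_vec q"
  shows "0 \<le> v \<bullet> (lap q a *\<^sub>v v)"
proof -
  have "0 \<le> (\<Sum>i<q. \<Sum>j<q. a i j * (v $ i - v $ j)\<^sup>2)"
    using assms by (intro sum_nonneg) (auto simp: coupling_array_def)
  then show ?thesis using lap_quadratic_form[OF assms] by simp
qed

lemma lap_quadratic_form_bound:
  assumes a: "coupling_array q a" and v: "v \<in> carrier_vec q" and ij: "i < q" "j < q"
  shows "a i j * (v $ i - v $ j)\<^sup>2 \<le> 2 * (v \<bullet> (lap q a *\<^sub>v v))"
proof -
  have nn: "0 \<le> a i j * (v $ i - v $ j)\<^sup>2" if "i < q" "j < q" for i j
    using a that by (auto simp: coupling_array_def)
  have "a i j * (v $ i - v $ j)\<^sup>2 \<le> (\<Sum>j<q. a i j * (v $ i - v $ j)\<^sup>2)"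
    using nn ij by (intro member_le_sum) auto
  also have "\<dots> \<le> (\<Sum>i<q. \<Sum>j<q. a i j * (v $ i - v $ j)\<^sup>2)"
    using nn ij by (intro member_le_sum[of i "{..<q}" "\<lambda>i. \<Sum>j<q. a i j * (v $ i - v $ j)\<^sup>2"] sum_nonneg) auto
  finally show ?thesis unfolding lap_quadratic_form[OF a v] .
qed

text \<open>
  A trajectory whose Laplacian form tends to zero has all its weighted differences
  \<open>a\<^sub>i\<^sub>j (v\<^sub>i - v\<^sub>j)\<close> tending to zero, since \<open>(a\<^sub>i\<^sub>j (v\<^sub>i - v\<^sub>j))\<^sup>2\<close> is at most \<open>a\<^sub>i\<^sub>j\<close>
  times twice the form. For constant trajectories this says that the zeros of the form are in the
  kernel of the Laplacian.
\<close>
lemma lap_tendsto_0: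
  assumes a: "coupling_array q a" and v: "\<And>t. v t \<in> carrier_vec q"
    and lim: "((\<lambda>t. v t \<bullet> (lap q a *\<^sub>v v t)) \<longlongrightarrow> 0) F" and u: "u \<in> carrier_vec q"
  shows "((\<lambda>t. u \<bullet> (lap q a *\<^sub>v v t)) \<longlongrightarrow> 0) F"
proof -
  have entry: "((\<lambda>t. a i j * (v t $ i - v t $ j)) \<longlongrightarrow> 0) F" if ij: "i < q" "j < q" for i j
  proof -
    have "((\<lambda>t. sqrt (a i j * (2 * (v t \<bullet> (lap q a *\<^sub>v v t))))) \<longlongrightarrow> sqrt (a i j * (2 * 0))) F"
      by (intro tendsto_intros lim)
    then have lim': "((\<lambda>t. sqrt (a i j * (2 * (v t \<bullet> (lap q a *\<^sub>v v t))))) \<longlongrightarrow> 0) F" by simp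
    have a0: "0 \<le> a i j" using a ij by (auto simp: coupling_array_def)
    have "\<bar>a i j * (v t $ i - v t $ j)\<bar> \<le> sqrt (a i j * (2 * (v t \<bullet> (lap q a *\<^sub>v v t))))" for t
    proof (rule real_le_rsqrt)
      have "\<bar>a i j * (v t $ i - v t $ j)\<bar>\<^sup>2 = a i j * (a i j * (v t $ i - v t $ j)\<^sup>2)"
        by (simp add: power2_eq_square algebra_simps)
      also have "\<dots> \<le> a i j * (2 * (v t \<bullet> (lap q a *\<^sub>v v t)))"
        by (intro mult_left_mono lap_quadratic_form_bound a v ij a0)
      finally show "\<bar>a i j * (v t $ i - v t $ j)\<bar>\<^sup>2 \<le> a i j * (2 * (v t \<bullet> (lap q a *\<^sub>v v t)))" .
    qed
    then show ?thesis
      by (intro tendsto_0_le[OF lim', of _ 1] always_eventually allI) (auto intro: order_trans[OF _ abs_ge_self])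
  qed
  have "((\<lambda>t. \<Sum>i<q. u $ i * (\<Sum>j<q. a i j * (v t $ i - v t $ j))) \<longlongrightarrow> (\<Sum>i<q. u $ i * (\<Sum>j<q. 0))) F"
    using entry by (intro tendsto_sum tendsto_mult tendsto_const) auto
  moreover have "u \<bullet> (lap q a *\<^sub>v v t) = (\<Sum>i<q. u $ i * (\<Sum>j<q. a i j * (v t $ i - v t $ j)))" for t
    unfolding scalar_prod_eq_sum[OF mult_mat_vec_carrier[OF lap_carrier v]]
    by (intro sum.cong refl) (simp add: lap_mult_vec[OF a v] del: index_mult_mat_vec)
  ultimately show ?thesis by simp
qed

lemma lap_shift_mult_vec:
  assumes "v \<in> carrier_vec q"
  shows "(lap q a + c \<cdot>\<^sub>m 1\<^sub>m q) *\<^sub>v v = lap q a *\<^sub>v v + c \<cdot>\<^sub>v v"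
proof -
  have "(c \<cdot>\<^sub>m 1\<^sub>m q) *\<^sub>v v = c \<cdot>\<^sub>v v" using assms
    by (intro eq_vecI) auto
  then show ?thesis using assms by (simp add: add_mult_distrib_mat_vec[of _ q q])
qed

lemma lap_shift_quadratic_form:
  assumes a: "coupling_array q a" and v: "v \<in> carrier_vec q"
  shows "c * (v \<bullet> v) \<le> v \<bullet> ((lap q a + c \<cdot>\<^sub>m 1\<^sub>m q) *\<^sub>v v)"
  using lap_quadratic_form_nonneg[OF a v] mult_mat_vec_carrier[OF lap_carrier v, of a]
  unfolding lap_shift_mult_vec[OF v]
  using v by (simp add: scalar_prod_add_distrib[of _ q])

lemma sym_pos_def_lap_shift:
  assumes a: "coupling_array q a" and c: "c > 0"
  shows "sym_pos_def q (lap q a + c \<cdot>\<^sub>m 1\<^sub>m q)"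
  unfolding sym_pos_def_def
proof (intro conjI ballI impI)
  show "transpose_mat (lap q a + c \<cdot>\<^sub>m 1\<^sub>m q) = lap q a + c \<cdot>\<^sub>m 1\<^sub>m q"
    using transpose_lap[OF a] by (subst transpose_add[of _ q q]) auto
  fix v :: "real vec" assume v: "v \<in> carrier_vec q" "v \<noteq> 0\<^sub>v q"
  have "0 < c * (v \<bullet> v)" using c scalar_prod_self_pos[OF v] by simp
  also have "\<dots> \<le> v \<bullet> ((lap q a + c \<cdot>\<^sub>m 1\<^sub>m q) *\<^sub>v v)" by (rule lap_shift_quadratic_form[OF a v(1)])
  finally show "0 < v \<bullet> ((lap q a + c \<cdot>\<^sub>m 1\<^sub>m q) *\<^sub>v v)" .
qed simp

section \<open>Bounded functions and Barbalat's lemma\<close>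

lemma Bfun_add:
  fixes f g :: "'t \<Rightarrow> real"
  assumes "Bfun f F" "Bfun g F"
  shows "Bfun (\<lambda>t. f t + g t) F"
proof -
  from assms obtain A B where "\<forall>\<^sub>F t in F. norm (f t) \<le> A" "\<forall>\<^sub>F t in F. norm (g t) \<le> B"
    by (auto elim!: BfunE)
  then have "\<forall>\<^sub>F t in F. norm (f t + g t) \<le> A + B"
    by eventually_elim (meson add_mono norm_triangle_le)
  then show ?thesis by (rule BfunI)
qed

lemma Bfun_mult:
  fixes f g :: "'t \<Rightarrow> real"
  assumes "Bfun f F" "Bfun g F"
  shows "Bfun (\<lambda>t. f t * g t) F"
proof -
  from assms obtain A B where "\<forall>\<^sub>F t in F. norm (f t) \<le> A" "\<forall>\<^sub>F t in F. norm (g t) \<le> B"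
    by (auto elim!: BfunE)
  then have "\<forall>\<^sub>F t in F. norm (f t * g t) \<le> A * B"
  proof eventually_elim
    case (elim t)
    then show ?case unfolding norm_mult by (intro mult_mono) (auto intro: order_trans[OF norm_ge_zero])
  qed
  then show ?thesis by (rule BfunI)
qed

lemma Bfun_sum:
  fixes f :: "'i \<Rightarrow> 't \<Rightarrow> real"
  assumes "\<And>i. i \<in> I \<Longrightarrow> Bfun (f i) F"
  shows "Bfun (\<lambda>t. \<Sum>i\<in>I. f i t) F"
  using assms
proof (induction I rule: infinite_finite_induct)
  case (insert i I)
  then show ?case by (simp add: Bfun_add)
qed (auto simp: Bfun_const)

lemma Bfun_scalar_prod:
  assumes "\<And>t. y t \<in> carrier_vec n" "\<And>t. z t \<in> carrier_vec n"
    and "\<And>i. i < n \<Longrightarrow> Bfun (\<lambda>t. y t $ i :: real) F" "\<And>i. i < n \<Longrightarrow> Bfun (\<lambda>t. z t $ i) F"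
  shows "Bfun (\<lambda>t. y t \<bullet> z t) F"
  unfolding scalar_prod_eq_sum[OF assms(2)] using assms by (auto intro!: Bfun_sum Bfun_mult)

text \<open>
  A bound \<open>C\<close> on \<open>f''\<close> gives \<open>|f'(t)| \<le> |f(t + h) - f(t)| / h + C h\<close>. The last term is made small
  by the choice of \<open>h\<close>, and the first one then tends to zero as \<open>t\<close> grows.
\<close>
lemma barbalat:
  fixes f f' f'' :: "real \<Rightarrow> real"
  assumes df: "\<And>t. t > 0 \<Longrightarrow> (f has_real_derivative f' t) (at t)"
    and df': "\<And>t. t > 0 \<Longrightarrow> (f' has_real_derivative f'' t) (at t)"
    and bdd: "Bfun f'' at_top" and lim: "(f \<longlongrightarrow> l) at_top"
  shows "(f' \<longlongrightarrow> 0) at_top"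
proof -
  from bdd obtain C where C: "C > 0" "\<forall>\<^sub>F t in at_top. \<bar>f'' t\<bar> \<le> C" by (auto elim!: BfunE)
  then obtain t0 where t0: "\<And>t. t \<ge> t0 \<Longrightarrow> \<bar>f'' t\<bar> \<le> C" by (auto simp: eventually_at_top_linorder)
  show ?thesis
  proof (rule tendstoI)
    fix e :: real assume e: "e > 0"
    define h where "h = e / (2 * C)"
    have h: "h > 0" "C * h = e / 2" using e C by (auto simp: h_def)
    have "filterlim (\<lambda>t. t + h) at_top at_top"
      using filterlim_tendsto_add_at_top[OF tendsto_const[of h] filterlim_ident] by (simp add: add.commute)
    from filterlim_compose[OF lim this]
    have "((\<lambda>t. f (t + h) - f t) \<longlongrightarrow> l - l) at_top"
      by (intro tendsto_diff lim)
    then have "\<forall>\<^sub>F t in at_top. dist (f (t + h) - f t) 0 < h * (e / 2)"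
      using e h by (intro tendstoD) auto
    moreover have "\<forall>\<^sub>F t in at_top. t \<ge> max 1 t0" by (rule eventually_ge_at_top)
    ultimately show "\<forall>\<^sub>F t in at_top. dist (f' t) 0 < e"
    proof eventually_elim
      case (elim t)
      then have t: "t > 0" "t \<ge> t0" by auto
      obtain s where s: "t < s" "s < t + h" "f (t + h) - f t = h * f' s"
        using MVT2[of t "t + h" f f'] df t h by auto
      obtain r where r: "t < r" "r < s" "f' s - f' t = (s - t) * f'' r"
        using MVT2[of t s f' f''] df' t s by auto
      have "h * \<bar>f' s\<bar> < h * (e / 2)" using elim s(3) h by (simp add: dist_real_def abs_mult)
      then have "\<bar>f' s\<bar> < e / 2" using h by simp
      moreover have "\<bar>f' s - f' t\<bar> \<le> h * C"
        unfolding r(3) abs_mult using s r t0[of r] t by (intro mult_mono) auto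
      then have "\<bar>f' s - f' t\<bar> \<le> e / 2" using h by (simp add: mult.commute)
      ultimately have "\<bar>f' t\<bar> < e" by linarith
      then show ?case by simp
    qed
  qed
qed

lemma nonincreasing_bounded_below_convergent:
  fixes f f' :: "real \<Rightarrow> real"
  assumes df: "\<And>t. t > 0 \<Longrightarrow> (f has_real_derivative f' t) (at t)"
    and neg: "\<And>t. t > 0 \<Longrightarrow> f' t \<le> 0" and lb: "\<And>t. t > 0 \<Longrightarrow> 0 \<le> f t"
  shows "\<And>s t. 0 < s \<Longrightarrow> s \<le> t \<Longrightarrow> f t \<le> f s" "\<exists>l. (f \<longlongrightarrow> l) at_top"
proof -
  show mono: "f t \<le> f s" if st: "0 < s" "s \<le> t" for s t
  proof (rule DERIV_nonpos_imp_nonincreasing[OF st(2)])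
    fix x assume "s \<le> x" "x \<le> t"
    then have "x > 0" using st by simp
    then show "\<exists>y. (f has_real_derivative y) (at x) \<and> y \<le> 0" using df neg by blast
  qed
  have bdd: "bdd_below (f ` {0<..})" using lb by (auto intro!: bdd_belowI)
  have "(f \<longlongrightarrow> Inf (f ` {0<..})) at_top"
  proof (rule decreasing_tendsto)
    show "\<forall>\<^sub>F t in at_top. Inf (f ` {0<..}) \<le> f t"
      using eventually_gt_at_top[of 0] by eventually_elim (auto intro!: cInf_lower bdd)
    fix x assume "Inf (f ` {0<..}) < x"
    then obtain s where s: "s > 0" "f s < x" using cInf_lessD[of "f ` {0<..}" x] by auto
    show "\<forall>\<^sub>F t in at_top. f t < x"
      using eventually_ge_at_top[of s] by eventually_elim (use mono[OF s(1)] s(2) in force)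
  qed
  then show "\<exists>l. (f \<longlongrightarrow> l) at_top" by blast
qed

lemma has_real_derivative_scalar_prod:
  fixes y y' z z' :: "real \<Rightarrow> real vec"
  assumes c: "\<And>t. y t \<in> carrier_vec n" "\<And>t. z t \<in> carrier_vec n"
      "\<And>t. y' t \<in> carrier_vec n" "\<And>t. z' t \<in> carrier_vec n"
    and "\<And>i. i < n \<Longrightarrow> ((\<lambda>s. y s $ i) has_real_derivative y' t $ i) (at t)"
    and "\<And>i. i < n \<Longrightarrow> ((\<lambda>s. z s $ i) has_real_derivative z' t $ i) (at t)"
  shows "((\<lambda>s. y s \<bullet> z s) has_real_derivative (y' t \<bullet> z t + y t \<bullet> z' t)) (at t)"
proof -
  have "((\<lambda>s. \<Sum>i<n. y s $ i * z s $ i) has_real_derivative (\<Sum>i<n. y' t $ i * z t $ i + z' t $ i * y t $ i)) (at t)"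
    by (intro DERIV_sum DERIV_mult assms) auto
  then show ?thesis using carrier_vecD[OF c(2)] carrier_vecD[OF c(4)]
    by (simp add: scalar_prod_def atLeast0LessThan sum.distrib mult.commute)
qed

lemma has_real_derivative_functional:
  fixes z z' :: "real \<Rightarrow> real vec"
  assumes "c \<in> carrier_vec n" "\<And>t. z t \<in> carrier_vec n" "\<And>t. z' t \<in> carrier_vec n"
    and "\<And>i. i < n \<Longrightarrow> ((\<lambda>s. z s $ i) has_real_derivative z' t $ i) (at t)"
  shows "((\<lambda>s. c \<bullet> z s) has_real_derivative c \<bullet> z' t) (at t)"
proof -
  have "((\<lambda>s. c \<bullet> z s) has_real_derivative (0\<^sub>v n \<bullet> z t + c \<bullet> z' t)) (at t)"
    by (rule has_real_derivative_scalar_prod[of "\<lambda>_. c" n z "\<lambda>_. 0\<^sub>v n" z']) (use assms in auto)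
  then show ?thesis using assms by simp
qed

lemma has_real_derivative_quadratic_form:
  fixes z z' :: "real \<Rightarrow> real vec"
  assumes A: "A \<in> carrier_mat n n" "transpose_mat A = A"
    and z: "\<And>t. z t \<in> carrier_vec n" "\<And>t. z' t \<in> carrier_vec n"
    and d: "\<And>i. i < n \<Longrightarrow> ((\<lambda>s. z s $ i) has_real_derivative z' t $ i) (at t)"
  shows "((\<lambda>s. z s \<bullet> (A *\<^sub>v z s)) has_real_derivative 2 * (z t \<bullet> (A *\<^sub>v z' t))) (at t)"
proof -
  have "((\<lambda>s. z s \<bullet> (A *\<^sub>v z s)) has_real_derivative (z' t \<bullet> (A *\<^sub>v z t) + z t \<bullet> (A *\<^sub>v z' t))) (at t)"
  proof (rule has_real_derivative_scalar_prod[of z n "\<lambda>s. A *\<^sub>v z s" z' "\<lambda>s. A *\<^sub>v z' s"])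
    fix i assume "i < n"
    then show "((\<lambda>s. (A *\<^sub>v z s) $ i) has_real_derivative (A *\<^sub>v z' t) $ i) (at t)"
      using has_real_derivative_functional[of "row A i" n z z', OF _ z d] A z by simp
  qed (use assms in auto)
  moreover have "z' t \<bullet> (A *\<^sub>v z t) = z t \<bullet> (A *\<^sub>v z' t)"
    using symmetric_mat_adjoint[OF A z(2) z(1), of t t] comm_scalar_prod[of "A *\<^sub>v z' t" n "z t"] A z by simp
  ultimately show ?thesis by simp
qed

lemma square_component_le:
  assumes "y \<in> carrier_vec n" "i < n"
  shows "(y $ i)\<^sup>2 \<le> y \<bullet> (y :: real vec)"
  unfolding scalar_prod_eq_sum[OF assms(1)] power2_eq_square
  using assms(2) by (intro member_le_sum[of i "{..<n}" "\<lambda>i. y $ i * y $ i"]) auto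

lemma has_real_derivative_within_halfline:
  assumes "(f has_real_derivative D) (at t within {0..})" "0 < t"
  shows "(f has_real_derivative D) (at t)"
proof -
  have "at t within {0..} = at t"
  proof (rule at_within_nhd)
    show "t \<in> {0<..}" using assms(2) by simp
  qed auto
  then show ?thesis using assms(1) by simp
qed

section \<open>The oscillators in mass-normalised coordinates\<close>

text \<open>
  \<open>T\<close> and \<open>R\<close> are the square root of the mass matrix \<open>N\<close> and its inverse; \<open>P\<close> and \<open>H\<close> are the
  damping and stiffness matrices that act on \<open>\<xi> = T x\<close>.
\<close>

locale coupled_oscillators =
  fixes q :: nat and m0 k0 :: real and m b k :: "nat \<Rightarrow> nat \<Rightarrow> real"
  assumes q2: "q \<ge> 2" and m0: "m0 > 0" and k0: "k0 > 0"
    and m: "coupling_array q m" and b: "coupling_array q b" and k: "coupling_array q k"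
begin

definition N where "N = lap q m + m0 \<cdot>\<^sub>m 1\<^sub>m q"
definition B where "B = lap q b"
definition L where "L = lap q k + k0 \<cdot>\<^sub>m 1\<^sub>m q"
definition T where "T = spd_sqrt N"
definition R where "R = spd_inv_sqrt N"
definition P where "P = R * (B * R)"
definition H where "H = R * (L * R)"
definition ones :: "real vec" where "ones = vec q (\<lambda>_. 1)"

lemma N_spd: "sym_pos_def q N"
  unfolding N_def by (rule sym_pos_def_lap_shift[OF m m0])

lemma L_spd: "sym_pos_def q L"
  unfolding L_def by (rule sym_pos_def_lap_shift[OF k k0])

lemma carriers [simp]:
  "N \<in> carrier_mat q q" "B \<in> carrier_mat q q" "L \<in> carrier_mat q q" "T \<in> carrier_mat q q"
  "R \<in> carrier_mat q q" "P \<in> carrier_mat q q" "H \<in> carrier_mat q q" "ones \<in> carrier_vec q"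
proof -
  show R: "R \<in> carrier_mat q q" unfolding R_def by (rule spd_inv_sqrt(1)[OF N_spd])
  show "T \<in> carrier_mat q q" using spd_sqrt(1)[OF N_spd] by (simp add: T_def sym_pos_def_def)
  show "N \<in> carrier_mat q q" and L: "L \<in> carrier_mat q q" and B: "B \<in> carrier_mat q q"
    by (simp_all add: N_def L_def B_def)
  show "P \<in> carrier_mat q q" "H \<in> carrier_mat q q"
    using R L B by (simp_all add: P_def H_def)
  show "ones \<in> carrier_vec q" by (simp add: ones_def)
qed

lemma dims [simp]:
  "dim_row N = q" "dim_row B = q" "dim_row L = q" "dim_row T = q" "dim_row R = q" "dim_row P = q" "dim_row H = q"
  "dim_col N = q" "dim_col B = q" "dim_col L = q" "dim_col T = q" "dim_col R = q" "dim_col P = q" "dim_col H = q"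
  "dim_vec ones = q"
  by (rule carrier_matD[OF carriers(1)] carrier_matD[OF carriers(2)] carrier_matD[OF carriers(3)]
    carrier_matD[OF carriers(4)] carrier_matD[OF carriers(5)] carrier_matD[OF carriers(6)]
    carrier_matD[OF carriers(7)] carrier_vecD[OF carriers(8)])+

lemma mult_carriers [simp]:
  assumes "v \<in> carrier_vec q"
  shows "N *\<^sub>v v \<in> carrier_vec q" "B *\<^sub>v v \<in> carrier_vec q" "L *\<^sub>v v \<in> carrier_vec q"
    "T *\<^sub>v v \<in> carrier_vec q" "R *\<^sub>v v \<in> carrier_vec q" "P *\<^sub>v v \<in> carrier_vec q"
    "H *\<^sub>v v \<in> carrier_vec q"
  using assms by (auto intro: mult_mat_vec_carrier[of _ q q])

lemma symmetric:
  "transpose_mat N = N" "transpose_mat B = B" "transpose_mat L = L" "transpose_mat T = T"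
  "transpose_mat R = R" "transpose_mat P = P" "transpose_mat H = H"
proof -
  show R: "transpose_mat R = R" unfolding R_def by (rule spd_inv_sqrt(2)[OF N_spd])
  show "transpose_mat T = T" using spd_sqrt(1)[OF N_spd] by (simp add: T_def sym_pos_def_def)
  show "transpose_mat N = N" using N_spd by (simp add: sym_pos_def_def)
  show L: "transpose_mat L = L" using L_spd by (simp add: sym_pos_def_def)
  show B: "transpose_mat B = B" unfolding B_def by (rule transpose_lap[OF b])
  have sandwich: "transpose_mat (R * (X * R)) = R * (X * R)"
    if X: "X \<in> carrier_mat q q" "transpose_mat X = X" for X
  proof -
    have "transpose_mat (R * (X * R)) = (transpose_mat R * transpose_mat X) * transpose_mat R"
      using transpose_mult[OF carriers(5) mult_carrier_mat[OF X(1) carriers(5)]]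
        transpose_mult[OF X(1) carriers(5)] by simp
    also have "\<dots> = R * (X * R)"
      unfolding R X(2) by (rule assoc_mult_mat[OF carriers(5) X(1) carriers(5)])
    finally show ?thesis .
  qed
  show "transpose_mat P = P" unfolding P_def by (rule sandwich[OF carriers(2) B])
  show "transpose_mat H = H" unfolding H_def by (rule sandwich[OF carriers(3) L])
qed

lemmas adjoint = symmetric_mat_adjoint[of _ q]

lemma sandwich_mult:
  assumes "X \<in> carrier_mat q q" "v \<in> carrier_vec q"
  shows "(R * (X * R)) *\<^sub>v v = R *\<^sub>v (X *\<^sub>v (R *\<^sub>v v))"
  using assoc_mult_mat_vec[OF carriers(5) mult_carrier_mat[OF assms(1) carriers(5)] assms(2)]
    assoc_mult_mat_vec[OF assms(1) carriers(5) assms(2)] by simp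

lemma P_mult: "v \<in> carrier_vec q \<Longrightarrow> P *\<^sub>v v = R *\<^sub>v (B *\<^sub>v (R *\<^sub>v v))"
  unfolding P_def by (rule sandwich_mult[OF carriers(2)])

lemma H_mult: "v \<in> carrier_vec q \<Longrightarrow> H *\<^sub>v v = R *\<^sub>v (L *\<^sub>v (R *\<^sub>v v))"
  unfolding H_def by (rule sandwich_mult[OF carriers(3)])

lemma RT: "v \<in> carrier_vec q \<Longrightarrow> R *\<^sub>v (T *\<^sub>v v) = v"
  using assoc_mult_mat_vec[OF carriers(5,4), of v] spd_inv_sqrt(4)[OF N_spd, folded T_def R_def] by simp

lemma TR: "v \<in> carrier_vec q \<Longrightarrow> T *\<^sub>v (R *\<^sub>v v) = v"
  using assoc_mult_mat_vec[OF carriers(4,5), of v] spd_inv_sqrt(3)[OF N_spd, folded T_def R_def] by simp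

lemma N_mult: "v \<in> carrier_vec q \<Longrightarrow> N *\<^sub>v v = T *\<^sub>v (T *\<^sub>v v)"
  using assoc_mult_mat_vec[OF carriers(4,4), of v] spd_sqrt(2)[OF N_spd, folded T_def] by simp

lemma R_ones: "R *\<^sub>v ones = (1 / sqrt m0) \<cdot>\<^sub>v ones"
  and T_ones: "T *\<^sub>v ones = sqrt m0 \<cdot>\<^sub>v ones"
  and B_ones: "B *\<^sub>v ones = 0\<^sub>v q"
  and L_ones: "L *\<^sub>v ones = k0 \<cdot>\<^sub>v ones"
proof -
  have lap1: "lap q a *\<^sub>v ones = 0\<^sub>v q" if "coupling_array q a" for a
    by (rule eq_vecI) (auto simp: lap_mult_vec[OF that] ones_def simp del: index_mult_mat_vec)
  show "B *\<^sub>v ones = 0\<^sub>v q" unfolding B_def by (rule lap1[OF b])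
  show "L *\<^sub>v ones = k0 \<cdot>\<^sub>v ones"
    unfolding L_def lap_shift_mult_vec[OF carriers(8)] lap1[OF k] by simp
  have N1: "N *\<^sub>v ones = m0 \<cdot>\<^sub>v ones"
    unfolding N_def lap_shift_mult_vec[OF carriers(8)] lap1[OF m] by simp
  show T1: "T *\<^sub>v ones = sqrt m0 \<cdot>\<^sub>v ones"
    unfolding T_def
  proof (rule sym_pos_def_sqrt_eigenvector[OF spd_sqrt(1)[OF N_spd] carriers(8)])
    show "(spd_sqrt N * spd_sqrt N) *\<^sub>v ones = (sqrt m0 * sqrt m0) \<cdot>\<^sub>v ones"
      unfolding spd_sqrt(2)[OF N_spd] N1 using m0 by simp
  qed (use m0 in simp)
  have "ones = R *\<^sub>v (sqrt m0 \<cdot>\<^sub>v ones)" unfolding T1[symmetric] by (simp add: RT)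
  also have "\<dots> = sqrt m0 \<cdot>\<^sub>v (R *\<^sub>v ones)" by (rule mult_mat_vec[of _ q q]) auto
  finally have "(1 / sqrt m0) \<cdot>\<^sub>v ones = (1 / sqrt m0) \<cdot>\<^sub>v (sqrt m0 \<cdot>\<^sub>v (R *\<^sub>v ones))"
    by (rule arg_cong)
  also have "\<dots> = R *\<^sub>v ones" using m0 by (simp add: smult_smult_assoc)
  finally show "R *\<^sub>v ones = (1 / sqrt m0) \<cdot>\<^sub>v ones" by (rule sym)
qed

lemma P_ones: "P *\<^sub>v ones = 0\<^sub>v q"
  and H_ones: "H *\<^sub>v ones = (k0 / m0) \<cdot>\<^sub>v ones"
proof -
  have "R *\<^sub>v 0\<^sub>v q = 0\<^sub>v q" "(1 / sqrt m0) \<cdot>\<^sub>v 0\<^sub>v q = 0\<^sub>v q" by auto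
  then show "P *\<^sub>v ones = 0\<^sub>v q"
    by (simp add: P_mult R_ones mult_mat_vec[of _ q q] B_ones)
  have "sqrt m0 * sqrt m0 = m0" using m0 by simp
  then show "H *\<^sub>v ones = (k0 / m0) \<cdot>\<^sub>v ones"
    by (simp add: H_mult R_ones mult_mat_vec[of _ q q] L_ones smult_smult_assoc field_simps)
qed

lemma P_quadratic_form:
  assumes v: "v \<in> carrier_vec q"
  shows "v \<bullet> (P *\<^sub>v v) = (R *\<^sub>v v) \<bullet> (B *\<^sub>v (R *\<^sub>v v))"
  using adjoint[OF _ symmetric(5) v, of "B *\<^sub>v (R *\<^sub>v v)"] v by (simp add: P_mult)

lemma P_nonneg: "v \<in> carrier_vec q \<Longrightarrow> 0 \<le> v \<bullet> (P *\<^sub>v v)"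
  using lap_quadratic_form_nonneg[OF b, of "R *\<^sub>v v"] by (simp add: P_quadratic_form B_def)

text \<open>
  \<open>v \<bullet> P v\<close> is the Laplacian form of \<open>B\<close> at \<open>R v\<close>; the constant trajectory \<open>R v\<close> shows that
  \<open>B (R v) = 0\<close> where it vanishes.
\<close>
lemma P_form_eq_0:
  assumes v: "v \<in> carrier_vec q" and 0: "v \<bullet> (P *\<^sub>v v) = 0"
  shows "P *\<^sub>v v = 0\<^sub>v q"
proof -
  have Rv: "R *\<^sub>v v \<in> carrier_vec q" using v by simp
  have "u \<bullet> (B *\<^sub>v (R *\<^sub>v v)) = 0" if u: "u \<in> carrier_vec q" for u
  proof -
    have "((\<lambda>t::real. u \<bullet> (lap q b *\<^sub>v (R *\<^sub>v v))) \<longlongrightarrow> 0) at_top"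
      by (rule lap_tendsto_0[OF b, of "\<lambda>_. R *\<^sub>v v"])
         (use Rv u 0 P_quadratic_form[OF v] in \<open>auto simp: B_def\<close>)
    then show ?thesis by (simp add: B_def tendsto_const_iff)
  qed
  then have "B *\<^sub>v (R *\<^sub>v v) = 0\<^sub>v q"
    using scalar_prod_self_eq_0[of "B *\<^sub>v (R *\<^sub>v v)" q] Rv by simp
  then show ?thesis unfolding P_mult[OF v] by (intro eq_vecI) auto
qed

lemma H_pos:
  assumes v: "v \<in> carrier_vec q" "v \<noteq> 0\<^sub>v q"
  shows "0 < v \<bullet> (H *\<^sub>v v)"
proof -
  have "R *\<^sub>v v \<noteq> 0\<^sub>v q"
  proof
    assume "R *\<^sub>v v = 0\<^sub>v q"
    then have "v = T *\<^sub>v 0\<^sub>v q" using TR[OF v(1)] by simp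
    also have "\<dots> = 0\<^sub>v q" by (rule eq_vecI) auto
    finally show False using v(2) by simp
  qed
  then have "0 < (R *\<^sub>v v) \<bullet> (L *\<^sub>v (R *\<^sub>v v))"
    using L_spd v(1) by (simp add: sym_pos_def_def)
  also have "\<dots> = v \<bullet> (H *\<^sub>v v)"
    using adjoint[OF _ symmetric(5) v(1), of "L *\<^sub>v (R *\<^sub>v v)"] v by (simp add: H_mult)
  finally show ?thesis .
qed

section \<open>Undamped modes prevent synchronization\<close>

text \<open>
  The condition \<open>P w = 0\<close> means that the oscillation of \<open>\<xi>\<close> along \<open>w\<close> is not felt by the dampers;
  \<open>ones \<bullet> w = 0\<close> rules out the synchronous oscillation, which is never damped.
\<close>
definition undamped_mode :: "real vec \<Rightarrow> bool" where
  "undamped_mode w \<longleftrightarrow> w \<in> carrier_vec q \<and> w \<noteq> 0\<^sub>v q \<and> ones \<bullet> w = 0 \<and>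
     P *\<^sub>v w = 0\<^sub>v q \<and> (\<exists>\<mu>. H *\<^sub>v w = \<mu> \<cdot>\<^sub>v w)"

lemma equation_of_motion_vec:
  assumes "i < q"
  shows "(N *\<^sub>v vec q w + B *\<^sub>v vec q v + L *\<^sub>v vec q x) $ i =
    m0 * w i + k0 * x i + (\<Sum>j<q. m i j * (w i - w j)) + (\<Sum>j<q. b i j * (v i - v j))
      + (\<Sum>j<q. k i j * (x i - x j))"
  using assms unfolding N_def B_def L_def
  by (simp add: lap_shift_mult_vec lap_mult_vec m b k del: index_mult_mat_vec)

text \<open>
  For \<open>y = R w\<close> the two conditions read \<open>B y = 0\<close> and \<open>L y = \<mu> N y\<close>, so \<open>cos (\<omega> t) y\<close> with
  \<open>\<omega>\<^sup>2 = \<mu>\<close> is a solution. It returns to \<open>y\<close> after every period; if it synchronized, \<open>y\<close> and with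
  it \<open>w\<close> would be a multiple of \<open>ones\<close>.
\<close>
lemma undamped_mode_not_synchronized:
  assumes "undamped_mode w"
  shows "\<not> oscillators_synchronize q m0 k0 m b k"
proof
  assume sync: "oscillators_synchronize q m0 k0 m b k"
  obtain \<mu> where w: "w \<in> carrier_vec q" "w \<noteq> 0\<^sub>v q" and w1: "ones \<bullet> w = 0"
    and Pw: "P *\<^sub>v w = 0\<^sub>v q" and Hw: "H *\<^sub>v w = \<mu> \<cdot>\<^sub>v w"
    using assms by (auto simp: undamped_mode_def)
  have "0 < \<mu> * (w \<bullet> w)" using H_pos[OF w] w by (simp add: Hw)
  then have \<mu>: "\<mu> > 0" using scalar_prod_self_pos[OF w] by (simp add: zero_less_mult_iff)
  define \<omega> where "\<omega> = sqrt \<mu>"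
  have \<omega>: "\<omega> > 0" "\<omega> * \<omega> = \<mu>" using \<mu> by (auto simp: \<omega>_def)
  define y where "y = R *\<^sub>v w"
  have y: "y \<in> carrier_vec q" using w by (simp add: y_def)
  have T0: "T *\<^sub>v 0\<^sub>v q = 0\<^sub>v q" by (rule eq_vecI) auto
  have By: "B *\<^sub>v y = 0\<^sub>v q"
    using arg_cong[OF Pw, of "\<lambda>v. T *\<^sub>v v"] w T0 by (simp add: P_mult TR y_def)
  have Ly: "L *\<^sub>v y = \<mu> \<cdot>\<^sub>v (N *\<^sub>v y)"
  proof -
    have "L *\<^sub>v y = T *\<^sub>v (H *\<^sub>v w)" using w by (simp add: H_mult TR y_def)
    also have "\<dots> = \<mu> \<cdot>\<^sub>v (T *\<^sub>v w)" unfolding Hw by (rule mult_mat_vec[OF carriers(4) w(1)])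
    also have "T *\<^sub>v w = N *\<^sub>v y" using w by (simp add: N_mult TR y_def)
    finally show ?thesis .
  qed
  define x where "x i t = cos (\<omega> * t) * y $ i" for i t
  define v where "v i t = - \<omega> * sin (\<omega> * t) * y $ i" for i t
  define a where "a i t = - \<mu> * cos (\<omega> * t) * y $ i" for i t
  have "oscillator_solution q m0 k0 m b k x"
    unfolding oscillator_solution_def
  proof (rule exI[of _ v], rule exI[of _ a], intro allI impI conjI)
    fix i and t :: real assume i: "i < q" and "t \<ge> 0"
    show "(x i has_real_derivative v i t) (at t within {0..})"
      unfolding x_def[abs_def] v_def by (auto intro!: derivative_eq_intros)
    show "(v i has_real_derivative a i t) (at t within {0..})"
      unfolding v_def[abs_def] a_def \<omega>(2)[symmetric] by (auto intro!: derivative_eq_intros)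
    have vecs: "vec q (\<lambda>i. a i t) = (- \<mu> * cos (\<omega> * t)) \<cdot>\<^sub>v y"
      "vec q (\<lambda>i. v i t) = (- \<omega> * sin (\<omega> * t)) \<cdot>\<^sub>v y" "vec q (\<lambda>i. x i t) = cos (\<omega> * t) \<cdot>\<^sub>v y"
      using y by (auto simp: a_def v_def x_def)
    have "(N *\<^sub>v vec q (\<lambda>i. a i t) + B *\<^sub>v vec q (\<lambda>i. v i t) + L *\<^sub>v vec q (\<lambda>i. x i t)) $ i = 0"
      unfolding vecs mult_mat_vec[OF carriers(1) y] mult_mat_vec[OF carriers(2) y]
        mult_mat_vec[OF carriers(3) y] By Ly using i by simp
    then show "m0 * a i t + k0 * x i t + (\<Sum>j<q. m i j * (a i t - a j t))
      + (\<Sum>j<q. b i j * (v i t - v j t)) + (\<Sum>j<q. k i j * (x i t - x j t)) = 0"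
      unfolding equation_of_motion_vec[OF i] .
  qed
  then have lim: "((\<lambda>t. \<bar>x i t - x j t\<bar>) \<longlongrightarrow> 0) at_top" if "i < q" "j < q" for i j
    using sync that by (auto simp: oscillators_synchronize_def)
  have const: "y $ i = y $ j" if ij: "i < q" "j < q" for i j
  proof -
    \<comment> \<open>Sample the solution at the multiples of its period.\<close>
    define s where "s n = 2 * pi / \<omega> * real n" for n
    have s: "filterlim s at_top sequentially"
      unfolding s_def
      by (rule filterlim_tendsto_pos_mult_at_top[OF tendsto_const _ filterlim_real_sequentially])
         (use \<omega>(1) in simp)
    have "cos (\<omega> * s n) = 1" for n
      using \<omega>(1) cos_2npi[of n] by (simp add: s_def mult_ac)
    then have "(\<lambda>n. \<bar>x i (s n) - x j (s n)\<bar>) = (\<lambda>n. \<bar>y $ i - y $ j\<bar>)"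
      by (simp add: x_def)
    then have "(\<lambda>n. \<bar>y $ i - y $ j\<bar>) \<longlonglongrightarrow> 0" using filterlim_compose[OF lim[OF ij] s] by simp
    then show ?thesis by (simp add: LIMSEQ_const_iff)
  qed
  have "y = (y $ 0) \<cdot>\<^sub>v ones"
  proof (rule eq_vecI)
    fix i assume "i < dim_vec ((y $ 0) \<cdot>\<^sub>v ones)"
    then show "y $ i = ((y $ 0) \<cdot>\<^sub>v ones) $ i" using const[of i 0] q2 by (simp add: ones_def)
  qed (use y in simp)
  then have "T *\<^sub>v y = T *\<^sub>v ((y $ 0) \<cdot>\<^sub>v ones)" by (rule arg_cong)
  also have "\<dots> = (y $ 0 * sqrt m0) \<cdot>\<^sub>v ones"
    unfolding mult_mat_vec[OF carriers(4,8)] T_ones by (rule smult_smult_assoc)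
  also have "T *\<^sub>v y = w" unfolding y_def by (rule TR[OF w(1)])
  finally have weq: "w = (y $ 0 * sqrt m0) \<cdot>\<^sub>v ones" .
  have "ones \<bullet> ones \<noteq> 0" using q2 by (simp add: ones_def scalar_prod_def)
  then have "y $ 0 * sqrt m0 = 0" using w1 unfolding weq by simp
  then have "w = 0\<^sub>v q" unfolding weq by (intro eq_vecI) auto
  with w(2) show False ..
qed

section \<open>Synchronization in the absence of undamped modes\<close>

text \<open>
  Observability. A vector \<open>z\<close> killed by these functionals has \<open>P H\<^sup>j (H z) = 0\<close> for \<open>j < q\<close>, so \<open>P\<close>
  vanishes on the Krylov space of \<open>H z\<close>, and that space is orthogonal to \<open>ones\<close>. An eigenvector
  of \<open>H\<close> in it would be an undamped mode. The exponents start at \<open>1\<close> since the dynamics control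
  \<open>P H\<^sup>j\<close> on positions for \<open>j \<ge> 1\<close>.
\<close>
lemma krylov_orbit_separates:
  assumes none: "\<nexists>w. undamped_mode w"
    and z: "z \<in> carrier_vec q" and z1: "ones \<bullet> z = 0"
    and zP: "\<And>i j. i < q \<Longrightarrow> j < q \<Longrightarrow> ((H ^\<^sub>m Suc j) *\<^sub>v (P *\<^sub>v unit_vec q i)) \<bullet> z = 0"
  shows "z = 0\<^sub>v q"
proof (rule ccontr)
  assume z0: "z \<noteq> 0\<^sub>v q"
  define c where "c = H *\<^sub>v z"
  have c: "c \<in> carrier_vec q" using z by (simp add: c_def)
  have "c \<noteq> 0\<^sub>v q" using H_pos[OF z z0] z by (auto simp: c_def)
  then obtain w \<mu> g where w: "w \<in> carrier_vec q" "w \<noteq> 0\<^sub>v q" "H *\<^sub>v w = \<mu> \<cdot>\<^sub>v w"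
    and g: "\<And>u. u \<in> carrier_vec q \<Longrightarrow> u \<bullet> w = (\<Sum>j<q. g j * (u \<bullet> ((H ^\<^sub>m j) *\<^sub>v c)))"
    using krylov_eigenvector[OF carriers(7) symmetric(7) c] by metis
  have Hj: "(H ^\<^sub>m j) *\<^sub>v v \<in> carrier_vec q" if "v \<in> carrier_vec q" for j v
    using pow_carrier_mat[OF carriers(7)] that by (rule mult_mat_vec_carrier)
  have Hjc: "u \<bullet> ((H ^\<^sub>m j) *\<^sub>v c) = ((H ^\<^sub>m Suc j) *\<^sub>v u) \<bullet> z" if u: "u \<in> carrier_vec q" for u j
  proof -
    have "u \<bullet> ((H ^\<^sub>m j) *\<^sub>v c) = ((H ^\<^sub>m j) *\<^sub>v u) \<bullet> (H *\<^sub>v z)"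
      using symmetric_mat_power_adjoint[OF carriers(7) symmetric(7) u c] by (simp add: c_def)
    also have "\<dots> = (H *\<^sub>v ((H ^\<^sub>m j) *\<^sub>v u)) \<bullet> z"
      by (rule adjoint[OF carriers(7) symmetric(7) Hj[OF u] z, symmetric])
    finally show ?thesis unfolding pow_mat_Suc_vec[OF carriers(7) u] .
  qed
  have "(H ^\<^sub>m j) *\<^sub>v ones = (k0 / m0) ^ j \<cdot>\<^sub>v ones" for j
  proof (induction j)
    case 0
    then show ?case by auto
  next
    case (Suc j)
    show ?case unfolding pow_mat_Suc_vec[OF carriers(7,8)] Suc mult_mat_vec[OF carriers(7,8)] H_ones
      by (simp add: smult_smult_assoc mult.commute)
  qed
  then have "ones \<bullet> w = 0" using z1 z by (simp add: g Hjc del: pow_mat.simps)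
  moreover have "P *\<^sub>v w = 0\<^sub>v q"
  proof (rule eq_vecI)
    fix i assume "i < dim_vec (0\<^sub>v q :: real vec)"
    then have i: "i < q" by simp
    have "(P *\<^sub>v w) $ i = (P *\<^sub>v w) \<bullet> unit_vec q i" using i w by simp
    also have "\<dots> = w \<bullet> (P *\<^sub>v unit_vec q i)" by (rule adjoint[OF carriers(6) symmetric(6) w(1)]) simp
    also have "\<dots> = (P *\<^sub>v unit_vec q i) \<bullet> w"
      by (rule comm_scalar_prod[OF w(1)], rule mult_mat_vec_carrier[OF carriers(6)]) simp
    also have "\<dots> = (\<Sum>j<q. g j * ((P *\<^sub>v unit_vec q i) \<bullet> ((H ^\<^sub>m j) *\<^sub>v c)))"
      by (rule g, rule mult_mat_vec_carrier[OF carriers(6)]) simp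
    also have "\<dots> = 0"
      using zP[OF i] Hjc[OF mult_mat_vec_carrier[OF carriers(6) unit_vec_carrier]] by simp
    finally show "(P *\<^sub>v w) $ i = 0\<^sub>v q $ i" using i by simp
  qed (simp)
  ultimately show False using none w by (auto simp: undamped_mode_def)
qed

text \<open>
  \<open>X\<close>, \<open>V\<close> and \<open>A\<close> are positions, velocities and accelerations of one solution. Restricting to
  \<open>t > 0\<close> gives two-sided derivatives.
\<close>
context
  fixes X V A :: "real \<Rightarrow> real vec"
  assumes vecs [simp]: "\<And>t. X t \<in> carrier_vec q" "\<And>t. V t \<in> carrier_vec q" "\<And>t. A t \<in> carrier_vec q"
    and dX: "\<And>i t. i < q \<Longrightarrow> 0 < t \<Longrightarrow> ((\<lambda>s. X s $ i) has_real_derivative V t $ i) (at t)"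
    and dV: "\<And>i t. i < q \<Longrightarrow> 0 < t \<Longrightarrow> ((\<lambda>s. V s $ i) has_real_derivative A t $ i) (at t)"
    and motion: "\<And>t. 0 < t \<Longrightarrow> N *\<^sub>v A t + B *\<^sub>v V t + L *\<^sub>v X t = 0\<^sub>v q"
begin

lemma functional_motion:
  assumes "0 < t" and c: "c \<in> carrier_vec q"
  shows "c \<bullet> (N *\<^sub>v A t) + c \<bullet> (B *\<^sub>v V t) + c \<bullet> (L *\<^sub>v X t) = 0"
proof -
  have "c \<bullet> (N *\<^sub>v A t + B *\<^sub>v V t + L *\<^sub>v X t) = 0" unfolding motion[OF assms(1)] using c by simp
  then show ?thesis using c
    by (subst (asm) scalar_prod_add_distrib[of _ q], simp_all)
       (subst (asm) scalar_prod_add_distrib[of _ q], simp_all)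
qed

lemma dX_functional: "c \<in> carrier_vec q \<Longrightarrow> 0 < t \<Longrightarrow> ((\<lambda>s. c \<bullet> X s) has_real_derivative c \<bullet> V t) (at t)"
  by (rule has_real_derivative_functional[of c q X V]) (auto simp: dX)

lemma dV_functional: "c \<in> carrier_vec q \<Longrightarrow> 0 < t \<Longrightarrow> ((\<lambda>s. c \<bullet> V s) has_real_derivative c \<bullet> A t) (at t)"
  by (rule has_real_derivative_functional[of c q V A]) (auto simp: dV)

definition energy :: "real \<Rightarrow> real" where
  "energy t = V t \<bullet> (N *\<^sub>v V t) + X t \<bullet> (L *\<^sub>v X t)"

lemma energy_derivative:
  assumes t: "0 < t"
  shows "(energy has_real_derivative - 2 * (V t \<bullet> (B *\<^sub>v V t))) (at t)"
proof -
  have "(energy has_real_derivative 2 * (V t \<bullet> (N *\<^sub>v A t)) + 2 * (X t \<bullet> (L *\<^sub>v V t))) (at t)"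
    unfolding energy_def[abs_def] using t
    by (intro DERIV_add has_real_derivative_quadratic_form[of _ q] symmetric) (auto simp: dX dV)
  moreover have "X t \<bullet> (L *\<^sub>v V t) = V t \<bullet> (L *\<^sub>v X t)"
    using adjoint[OF carriers(3) symmetric(3), of "X t" "V t"] comm_scalar_prod[of "L *\<^sub>v X t" q "V t"] by simp
  moreover have "V t \<bullet> (N *\<^sub>v A t) + V t \<bullet> (L *\<^sub>v X t) = - (V t \<bullet> (B *\<^sub>v V t))"
    using functional_motion[OF t, of "V t"] by simp
  then have "2 * (V t \<bullet> (N *\<^sub>v A t)) + 2 * (V t \<bullet> (L *\<^sub>v X t)) = - 2 * (V t \<bullet> (B *\<^sub>v V t))" by simp
  ultimately show ?thesis by simp
qed

lemma energy_ge: "m0 * (V t \<bullet> V t) + k0 * (X t \<bullet> X t) \<le> energy t"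
  unfolding energy_def N_def L_def by (intro add_mono lap_shift_quadratic_form m k) simp_all

lemma energy_nonneg: "0 \<le> energy t"
  using energy_ge[of t] m0 k0 scalar_prod_self_nonneg[of "V t"] scalar_prod_self_nonneg[of "X t"]
  by (smt (verit) mult_nonneg_nonneg)

text \<open>The energy is dissipated at the rate \<open>2 (V \<bullet> B V) \<ge> 0\<close> and bounded below by zero.\<close>
lemma energy_decreasing: "0 < s \<Longrightarrow> s \<le> t \<Longrightarrow> energy t \<le> energy s"
  and energy_convergent: "\<exists>l. (energy \<longlongrightarrow> l) at_top"
proof -
  have diss: "- 2 * (V t \<bullet> (B *\<^sub>v V t)) \<le> 0" for t
    using lap_quadratic_form_nonneg[OF b, of "V t"] by (simp add: B_def)
  show "0 < s \<Longrightarrow> s \<le> t \<Longrightarrow> energy t \<le> energy s" "\<exists>l. (energy \<longlongrightarrow> l) at_top"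
    using nonincreasing_bounded_below_convergent[OF energy_derivative diss energy_nonneg] by auto
qed

lemma Bfun_functional_of_energy_bound:
  assumes y: "\<And>t. y t \<in> carrier_vec q" and c: "c > 0" and le: "\<And>t. c * (y t \<bullet> y t) \<le> energy t"
    and u: "u \<in> carrier_vec q"
  shows "Bfun (\<lambda>t. u \<bullet> y t) at_top"
proof (rule Bfun_scalar_prod[of _ q])
  fix i assume i: "i < q"
  show "Bfun (\<lambda>t. y t $ i) at_top"
  proof (rule BfunI)
    show "\<forall>\<^sub>F t in at_top. norm (y t $ i) \<le> 1 + energy 1 / c"
      using eventually_ge_at_top[of 1]
    proof eventually_elim
      case (elim t)
      have "c * (y t $ i)\<^sup>2 \<le> c * (y t \<bullet> y t)"
        using square_component_le[OF y i] c by (intro mult_left_mono) auto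
      also have "\<dots> \<le> energy 1" using le[of t] energy_decreasing[of 1 t] elim by simp
      finally have "(y t $ i)\<^sup>2 \<le> energy 1 / c" using c by (simp add: field_simps)
      moreover have "\<bar>y t $ i\<bar> \<le> 1 + (y t $ i)\<^sup>2"
        using zero_le_power2[of "\<bar>y t $ i\<bar> - 1"] zero_le_power2[of "y t $ i"] by (simp add: power2_diff)
      ultimately show ?case by simp
    qed
  qed
qed (use y u in \<open>auto simp: Bfun_const\<close>)

lemma Bfun_X: "u \<in> carrier_vec q \<Longrightarrow> Bfun (\<lambda>t. u \<bullet> X t) at_top"
proof (rule Bfun_functional_of_energy_bound[OF _ k0])
  show "k0 * (X t \<bullet> X t) \<le> energy t" for t
    using energy_ge[of t] mult_nonneg_nonneg[OF less_imp_le[OF m0] scalar_prod_self_nonneg[of "V t"]] by simp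
qed simp_all

lemma Bfun_V: "u \<in> carrier_vec q \<Longrightarrow> Bfun (\<lambda>t. u \<bullet> V t) at_top"
proof (rule Bfun_functional_of_energy_bound[OF _ m0])
  show "m0 * (V t \<bullet> V t) \<le> energy t" for t
    using energy_ge[of t] mult_nonneg_nonneg[OF less_imp_le[OF k0] scalar_prod_self_nonneg[of "X t"]] by simp
qed simp_all

text \<open>
  The equation \<open>\<xi>'' = - P \<xi>' - H \<xi>\<close> tested against \<open>c\<close>, with all matrices moved to the side of \<open>c\<close>:
  the functional \<open>T c\<close> of \<open>x\<close> is the functional \<open>c\<close> of \<open>\<xi>\<close>.
\<close>
lemma functional_acceleration:
  assumes t: "0 < t" and c: "c \<in> carrier_vec q"
  shows "(T *\<^sub>v c) \<bullet> A t = - ((B *\<^sub>v (R *\<^sub>v c)) \<bullet> V t) - ((L *\<^sub>v (R *\<^sub>v c)) \<bullet> X t)"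
proof -
  have "T *\<^sub>v c = N *\<^sub>v (R *\<^sub>v c)" using c by (simp add: N_mult TR)
  then have "(T *\<^sub>v c) \<bullet> A t = (R *\<^sub>v c) \<bullet> (N *\<^sub>v A t)"
    using adjoint[OF carriers(1) symmetric(1), of "R *\<^sub>v c" "A t"] c by simp
  also have "\<dots> = - ((R *\<^sub>v c) \<bullet> (B *\<^sub>v V t)) - ((R *\<^sub>v c) \<bullet> (L *\<^sub>v X t))"
    using functional_motion[OF t, of "R *\<^sub>v c"] c by simp
  finally show ?thesis
    using adjoint[OF carriers(2) symmetric(2), of "R *\<^sub>v c" "V t"]
      adjoint[OF carriers(3) symmetric(3), of "R *\<^sub>v c" "X t"] c by simp
qed

lemma Bfun_A:
  assumes c: "c \<in> carrier_vec q"
  shows "Bfun (\<lambda>t. c \<bullet> A t) at_top"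
proof -
  let ?f = "\<lambda>t. - 1 * ((B *\<^sub>v (R *\<^sub>v (R *\<^sub>v c))) \<bullet> V t) + - 1 * ((L *\<^sub>v (R *\<^sub>v (R *\<^sub>v c))) \<bullet> X t)"
  have "Bfun ?f at_top"
    using c by (intro Bfun_add Bfun_mult Bfun_const Bfun_V Bfun_X) auto
  then obtain K where K: "\<forall>\<^sub>F t in at_top. norm (?f t) \<le> K" by (auto elim: BfunE)
  have eq: "?f t = c \<bullet> A t" if "0 < t" for t
    using functional_acceleration[OF that, of "R *\<^sub>v c"] c by (simp add: TR)
  have "\<forall>\<^sub>F t in at_top. norm (c \<bullet> A t) \<le> K"
    using K eventually_gt_at_top[of 0] by eventually_elim (simp only: eq)
  then show ?thesis by (rule BfunI)
qed

text \<open>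
  The energy converges and its second derivative is bounded, so by Barbalat's lemma its derivative
  \<open>- 2 (V \<bullet> B V)\<close> tends to zero.
\<close>
lemma damping_force_tendsto_0:
  assumes u: "u \<in> carrier_vec q"
  shows "((\<lambda>t. u \<bullet> (B *\<^sub>v V t)) \<longlongrightarrow> 0) at_top"
proof -
  obtain l where l: "(energy \<longlongrightarrow> l) at_top" using energy_convergent by blast
  have "((\<lambda>t. - 2 * (V t \<bullet> (B *\<^sub>v V t))) \<longlongrightarrow> 0) at_top"
  proof (rule barbalat[OF energy_derivative _ _ l])
    show "((\<lambda>t. - 2 * (V t \<bullet> (B *\<^sub>v V t))) has_real_derivative - 2 * (2 * (V t \<bullet> (B *\<^sub>v A t)))) (at t)"
      if "0 < t" for t
      using that by (intro DERIV_cmult has_real_derivative_quadratic_form[of _ q] symmetric) (auto simp: dV)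
    have "Bfun (\<lambda>t. V t \<bullet> (B *\<^sub>v A t)) at_top"
    proof (rule Bfun_scalar_prod[of _ q])
      fix i assume i: "i < q"
      show "Bfun (\<lambda>t. V t $ i) at_top" using Bfun_V[of "unit_vec q i"] i by simp
      show "Bfun (\<lambda>t. (B *\<^sub>v A t) $ i) at_top"
        using Bfun_A[of "row B i"] row_carrier_vec[of i q B q] i by simp
    qed simp_all
    then show "Bfun (\<lambda>t. - 2 * (2 * (V t \<bullet> (B *\<^sub>v A t)))) at_top"
      by (intro Bfun_mult Bfun_const)
  qed
  then have "((\<lambda>t. (- 1 / 2) * (- 2 * (V t \<bullet> (B *\<^sub>v V t)))) \<longlongrightarrow> (- 1 / 2) * 0) at_top"
    by (intro tendsto_mult tendsto_const)
  then have "((\<lambda>t. V t \<bullet> (lap q b *\<^sub>v V t)) \<longlongrightarrow> 0) at_top" by (simp add: B_def)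
  from lap_tendsto_0[OF b vecs(2) this u] show ?thesis by (simp add: B_def)
qed

text \<open>
  Let \<open>c \<bullet> \<xi>' \<rightarrow> 0\<close>. Barbalat's lemma gives \<open>c \<bullet> \<xi>'' \<rightarrow> 0\<close>, and as the damping term
  \<open>c \<bullet> P \<xi>'\<close> tends to zero, so does \<open>c \<bullet> H \<xi> = H c \<bullet> \<xi>\<close>. A second application of Barbalat's lemma
  passes to the derivative \<open>H c \<bullet> \<xi>'\<close>, so the step can be iterated.
\<close>
lemma decaying_functional_step:
  assumes c: "c \<in> carrier_vec q" and lim: "((\<lambda>t. (T *\<^sub>v c) \<bullet> V t) \<longlongrightarrow> 0) at_top"
  shows "((\<lambda>t. (T *\<^sub>v (H *\<^sub>v c)) \<bullet> X t) \<longlongrightarrow> 0) at_top"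
    and "((\<lambda>t. (T *\<^sub>v (H *\<^sub>v c)) \<bullet> V t) \<longlongrightarrow> 0) at_top"
proof -
  let ?b = "B *\<^sub>v (R *\<^sub>v c)" and ?l = "L *\<^sub>v (R *\<^sub>v c)"
  have THc: "T *\<^sub>v (H *\<^sub>v c) = ?l" using c by (simp add: H_mult TR)
  have "((\<lambda>t. - (?b \<bullet> V t) - ?l \<bullet> X t) \<longlongrightarrow> 0) at_top"
  proof (rule barbalat[OF _ _ _ lim])
    show "((\<lambda>t. (T *\<^sub>v c) \<bullet> V t) has_real_derivative - (?b \<bullet> V t) - ?l \<bullet> X t) (at t)" if "0 < t" for t
      using dV_functional[of "T *\<^sub>v c" t] that c functional_acceleration[OF that c] by simp
    show "((\<lambda>t. - (?b \<bullet> V t) - ?l \<bullet> X t) has_real_derivative (- 1 * (?b \<bullet> A t) + - 1 * (?l \<bullet> V t))) (at t)"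
      if "0 < t" for t
      using that c by (auto intro!: derivative_eq_intros dV_functional dX_functional)
    show "Bfun (\<lambda>t. - 1 * (?b \<bullet> A t) + - 1 * (?l \<bullet> V t)) at_top"
      using c by (intro Bfun_add Bfun_mult Bfun_const Bfun_A Bfun_V) auto
  qed
  moreover have "((\<lambda>t. ?b \<bullet> V t) \<longlongrightarrow> 0) at_top"
  proof -
    have "?b \<bullet> V t = (R *\<^sub>v c) \<bullet> (B *\<^sub>v V t)" for t
      using adjoint[OF carriers(2) symmetric(2), of "R *\<^sub>v c" "V t"] c by simp
    then show ?thesis using damping_force_tendsto_0[of "R *\<^sub>v c"] c by simp
  qed
  ultimately have "((\<lambda>t. - (- (?b \<bullet> V t) - ?l \<bullet> X t) - ?b \<bullet> V t) \<longlongrightarrow> - 0 - 0) at_top"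
    by (intro tendsto_diff tendsto_minus)
  then have limX: "((\<lambda>t. ?l \<bullet> X t) \<longlongrightarrow> 0) at_top" by simp
  then show "((\<lambda>t. (T *\<^sub>v (H *\<^sub>v c)) \<bullet> X t) \<longlongrightarrow> 0) at_top" unfolding THc .
  have "((\<lambda>t. ?l \<bullet> V t) \<longlongrightarrow> 0) at_top"
    by (rule barbalat[OF dX_functional dV_functional Bfun_A limX]) (use c in auto)
  then show "((\<lambda>t. (T *\<^sub>v (H *\<^sub>v c)) \<bullet> V t) \<longlongrightarrow> 0) at_top" unfolding THc .
qed

text \<open>
  The iteration starts with \<open>c = P e\<^sub>i\<close>, for which \<open>c \<bullet> \<xi>'\<close> is a component of the damping force.
\<close>
lemma krylov_orbit_decays:
  assumes i: "i < q"
  defines "c j \<equiv> (H ^\<^sub>m j) *\<^sub>v (P *\<^sub>v unit_vec q i)"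
  shows "c j \<in> carrier_vec q" "c j \<bullet> ones = 0" "((\<lambda>t. (T *\<^sub>v c j) \<bullet> V t) \<longlongrightarrow> 0) at_top"
    "((\<lambda>t. (T *\<^sub>v c (Suc j)) \<bullet> X t) \<longlongrightarrow> 0) at_top"
proof -
  have Pe: "P *\<^sub>v unit_vec q i \<in> carrier_vec q" by simp
  have cSuc: "c (Suc j) = H *\<^sub>v c j" for j unfolding c_def by (rule pow_mat_Suc_vec[OF carriers(7) Pe])
  have c0: "c 0 = P *\<^sub>v unit_vec q i" using carriers(7) Pe by (simp add: c_def)
  show carr: "c j \<in> carrier_vec q" for j
    unfolding c_def by (rule mult_mat_vec_carrier[OF pow_carrier_mat[OF carriers(7)] Pe])
  show "c j \<bullet> ones = 0"
  proof (induction j)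
    case 0
    show ?case unfolding c0 using adjoint[OF carriers(6) symmetric(6), of "unit_vec q i" ones] by (simp add: P_ones)
  next
    case (Suc j)
    then show ?case unfolding cSuc
      using adjoint[OF carriers(7) symmetric(7) carr, of ones] carr[of j] by (simp add: H_ones)
  qed
  show limV: "((\<lambda>t. (T *\<^sub>v c j) \<bullet> V t) \<longlongrightarrow> 0) at_top" for j
  proof (induction j)
    case 0
    let ?e = "unit_vec q i :: real vec"
    have "(T *\<^sub>v c 0) \<bullet> V t = (R *\<^sub>v ?e) \<bullet> (B *\<^sub>v V t)" for t
      using adjoint[OF carriers(2) symmetric(2), of "R *\<^sub>v ?e" "V t"] by (simp add: c0 P_mult TR)
    then show ?case using damping_force_tendsto_0[of "R *\<^sub>v ?e"] by simp
  next
    case (Suc j)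
    show ?case unfolding cSuc by (rule decaying_functional_step(2)[OF carr Suc])
  qed
  show "((\<lambda>t. (T *\<^sub>v c (Suc j)) \<bullet> X t) \<longlongrightarrow> 0) at_top"
    unfolding cSuc by (rule decaying_functional_step(1)[OF carr limV])
qed

text \<open>
  The functionals \<open>H\<^bsup>j+1\<^esup> P e\<^sub>i\<close> together with \<open>ones\<close> separate points. They are applied to \<open>z\<close>, the
  part of \<open>\<xi>\<close> orthogonal to \<open>ones\<close>: the orbit functionals annihilate \<open>ones\<close> and so take the same
  values on \<open>z\<close> and \<open>\<xi>\<close>.
\<close>
lemma balanced_functional_tendsto_0:
  assumes none: "\<nexists>w. undamped_mode w" and d: "d \<in> carrier_vec q" and d1: "d \<bullet> ones = 0"
  shows "((\<lambda>t. d \<bullet> X t) \<longlongrightarrow> 0) at_top"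
proof -
  define \<beta> where "\<beta> t = (ones \<bullet> (T *\<^sub>v X t)) / real q" for t
  define z where "z t = T *\<^sub>v X t - \<beta> t \<cdot>\<^sub>v ones" for t
  define c where "c = (\<lambda>(i, j). (H ^\<^sub>m Suc j) *\<^sub>v (P *\<^sub>v unit_vec q i))"
  define S where "S = insert ones (c ` ({..<q} \<times> {..<q}))"
  have z: "z t \<in> carrier_vec q" for t by (simp add: z_def)
  have uz: "u \<bullet> z t = (T *\<^sub>v u) \<bullet> X t - \<beta> t * (u \<bullet> ones)" if "u \<in> carrier_vec q" for u t
    using that adjoint[OF carriers(4) symmetric(4) that, of "X t"]
    by (simp add: z_def scalar_prod_minus_distrib[of _ q])
  have c: "c (i, j) \<in> carrier_vec q" "c (i, j) \<bullet> ones = 0" "((\<lambda>t. (T *\<^sub>v c (i, j)) \<bullet> X t) \<longlongrightarrow> 0) at_top"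
    if "i < q" for i j
    unfolding c_def prod.case by (rule krylov_orbit_decays[OF that])+
  have "((\<lambda>t. (R *\<^sub>v d) \<bullet> z t) \<longlongrightarrow> 0) at_top"
  proof (rule separating_functionals_tendsto_0[of S q z])
    show "finite S" by (simp add: S_def)
    show "S \<subseteq> carrier_vec q" using c(1) by (auto simp: S_def)
    show "y = 0\<^sub>v q" if y: "y \<in> carrier_vec q" and S0: "\<And>s. s \<in> S \<Longrightarrow> s \<bullet> y = 0" for y
    proof (rule krylov_orbit_separates[OF none y])
      show "ones \<bullet> y = 0" using S0 by (simp add: S_def)
      show "((H ^\<^sub>m Suc j) *\<^sub>v (P *\<^sub>v unit_vec q i)) \<bullet> y = 0" if "i < q" "j < q" for i j
      proof -
        have "c (i, j) \<in> S" using that by (simp add: S_def)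
        from S0[OF this] show ?thesis by (simp only: c_def prod.case)
      qed
    qed
    show "((\<lambda>t. s \<bullet> z t) \<longlongrightarrow> 0) at_top" if sS: "s \<in> S" for s
    proof -
      consider "s = ones" | i j where "i < q" "s = c (i, j)" using sS by (auto simp: S_def)
      then show ?thesis
      proof cases
        case 1
        have "ones \<bullet> ones = real q" by (simp add: ones_def scalar_prod_def)
        moreover have "(T *\<^sub>v ones) \<bullet> X t = ones \<bullet> (T *\<^sub>v X t)" for t
          by (rule adjoint[OF carriers(4) symmetric(4)]) simp_all
        ultimately have "ones \<bullet> z t = 0" for t using q2 by (simp add: uz \<beta>_def)
        then show ?thesis by (simp add: 1)
      next
        case 2
        then show ?thesis using c[of i j] by (simp add: uz)
      qed
    qed
  qed (use z d in simp_all)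
  moreover have "(R *\<^sub>v d) \<bullet> z t = d \<bullet> X t" for t
  proof -
    have "(R *\<^sub>v d) \<bullet> ones = 0"
      using adjoint[OF carriers(5) symmetric(5) d, of ones] d d1 by (simp add: R_ones)
    then show ?thesis using d by (simp add: uz TR)
  qed
  ultimately show ?thesis by simp
qed

end

lemma synchronize_iff_no_undamped_mode:
  "oscillators_synchronize q m0 k0 m b k \<longleftrightarrow> (\<nexists>w. undamped_mode w)"
proof
  assume none: "\<nexists>w. undamped_mode w"
  show "oscillators_synchronize q m0 k0 m b k"
    unfolding oscillators_synchronize_def
  proof (intro allI impI)
    fix x i j assume "oscillator_solution q m0 k0 m b k x" and ij: "i < q" "j < q"
    then obtain v a where dx: "\<And>i t. i < q \<Longrightarrow> t \<ge> 0 \<Longrightarrow> (x i has_real_derivative v i t) (at t within {0..})"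
      and dv: "\<And>i t. i < q \<Longrightarrow> t \<ge> 0 \<Longrightarrow> (v i has_real_derivative a i t) (at t within {0..})"
      and motion: "\<And>i t. i < q \<Longrightarrow> t \<ge> 0 \<Longrightarrow> m0 * a i t + k0 * x i t
          + (\<Sum>j<q. m i j * (a i t - a j t)) + (\<Sum>j<q. b i j * (v i t - v j t))
          + (\<Sum>j<q. k i j * (x i t - x j t)) = 0"
      unfolding oscillator_solution_def by blast
    define X where "X t = vec q (\<lambda>i. x i t)" for t
    define V where "V t = vec q (\<lambda>i. v i t)" for t
    define A where "A t = vec q (\<lambda>i. a i t)" for t
    let ?d = "unit_vec q i - unit_vec q j :: real vec"
    have "((\<lambda>t. ?d \<bullet> X t) \<longlongrightarrow> 0) at_top"
    proof (rule balanced_functional_tendsto_0[of X V A, OF _ _ _ _ _ _ none])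
      show "((\<lambda>s. X s $ i) has_real_derivative V t $ i) (at t)"
        "((\<lambda>s. V s $ i) has_real_derivative A t $ i) (at t)" if "i < q" "0 < t" for i t
        using dx[of i t] dv[of i t] that
        by (auto simp: X_def V_def A_def intro: has_real_derivative_within_halfline)
      show "N *\<^sub>v A t + B *\<^sub>v V t + L *\<^sub>v X t = 0\<^sub>v q" if "0 < t" for t
      proof (rule eq_vecI)
        fix i assume "i < dim_vec (0\<^sub>v q :: real vec)"
        then have i: "i < q" by simp
        show "(N *\<^sub>v A t + B *\<^sub>v V t + L *\<^sub>v X t) $ i = 0\<^sub>v q $ i"
          unfolding X_def V_def A_def equation_of_motion_vec[OF i] using motion[OF i, of t] that i by simp
      qed simp
      show "?d \<bullet> ones = 0" using ij by (simp add: minus_scalar_prod_distrib[of _ q] ones_def)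
    qed (simp_all add: X_def V_def A_def)
    moreover have "?d \<bullet> X t = x i t - x j t" for t
      using ij by (simp add: minus_scalar_prod_distrib[of _ q] X_def)
    ultimately show "((\<lambda>t. \<bar>x i t - x j t\<bar>) \<longlongrightarrow> 0) at_top"
      using tendsto_rabs_zero by force
  qed
qed (use undamped_mode_not_synchronized in blast)

end

section \<open>Deflation and the second eigenvalue\<close>

text \<open>
  If the rows of \<open>M\<close> sum to zero, this is the matrix of the map that \<open>M\<close> induces on the quotient by
  the line spanned by the vector of ones, in the basis of the classes of \<open>e\<^sub>1, \<dots>, e\<^sub>n\<close>: the
  coordinates of the class of \<open>w\<close> are the differences \<open>w\<^bsub>i+1\<^esub> - w\<^sub>0\<close>.
\<close>
definition deflate :: "nat \<Rightarrow> 'a :: comm_ring_1 mat \<Rightarrow> 'a mat" where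
  "deflate n M = mat n n (\<lambda>(i, j). M $$ (Suc i, Suc j) - M $$ (0, Suc j))"

text \<open>
  In the basis consisting of the vector of ones and \<open>e\<^sub>1, \<dots>, e\<^sub>n\<close> the matrix \<open>M\<close> becomes block upper
  triangular, with the zero block of size \<open>1\<close> in the corner and the deflated matrix below it.
\<close>
lemma char_poly_deflate:
  fixes M :: "'a :: field mat"
  assumes M: "M \<in> carrier_mat (Suc n) (Suc n)"
    and row: "\<And>i. i \<le> n \<Longrightarrow> (\<Sum>j\<le>n. M $$ (i, j)) = 0"
  shows "char_poly M = [:0, 1:] * char_poly (deflate n M)"
proof -
  define F where "F = four_block_mat (0\<^sub>m 1 1) (mat 1 n (\<lambda>(i, j). M $$ (0, Suc j))) (0\<^sub>m n 1) (deflate n M)"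
  \<comment> \<open>\<open>Q 1\<close> has the new basis vectors as columns, and \<open>Q (- 1)\<close> is its inverse.\<close>
  define Q where "Q s = mat (Suc n) (Suc n) (\<lambda>(i, j). if i = j then 1 else if j = 0 then s else 0)" for s :: 'a
  have D: "deflate n M \<in> carrier_mat n n" by (simp add: deflate_def)
  have F: "F \<in> carrier_mat (Suc n) (Suc n)" 
    using four_block_carrier_mat[OF zero_carrier_mat[of 1 1] D] by (simp add: F_def)
  have Fij: "F $$ (i, j) = (if j = 0 then 0 else if i = 0 then M $$ (0, j) else M $$ (i, j) - M $$ (0, j))"
    if "i \<le> n" "j \<le> n" for i j
    unfolding F_def using that D by (subst index_mat_four_block) (auto simp: deflate_def)
  have Q: "Q s \<in> carrier_mat (Suc n) (Suc n)" for s by (simp add: Q_def)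
  have QX: "(Q s * X) $$ (i, j) = X $$ (i, j) + (if i = 0 then 0 else s * X $$ (0, j))"
    if X: "X \<in> carrier_mat (Suc n) (Suc n)" and ij: "i \<le> n" "j \<le> n" for X s i j
  proof -
    have "(Q s * X) $$ (i, j) = (\<Sum>l\<le>n. (if i = l then 1 else if l = 0 then s else 0) * X $$ (l, j))"
      using X ij by (simp add: Q_def scalar_prod_def atLeast0LessThan lessThan_Suc_atMost)
    also have "\<dots> = (\<Sum>l\<le>n. (if l = i then X $$ (i, j) else 0) + (if l = 0 then (if i = 0 then 0 else s * X $$ (0, j)) else 0))"
      by (intro sum.cong) auto
    also have "\<dots> = X $$ (i, j) + (if i = 0 then 0 else s * X $$ (0, j))"
      using ij by (simp add: sum.distrib)
    finally show ?thesis .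
  qed
  have QQ: "Q s * Q (- s) = 1\<^sub>m (Suc n)" for s
  proof (rule eq_matI)
    fix i j assume "i < dim_row (1\<^sub>m (Suc n) :: 'a mat)" "j < dim_col (1\<^sub>m (Suc n) :: 'a mat)"
    then have ij: "i \<le> n" "j \<le> n" by auto
    show "(Q s * Q (- s)) $$ (i, j) = 1\<^sub>m (Suc n) $$ (i, j)"
      unfolding QX[OF Q ij] using ij by (auto simp: Q_def)
  qed (simp_all add: Q_def)
  have MQ: "M * Q 1 = Q 1 * F"
  proof (rule eq_matI)
    fix i j assume "i < dim_row (Q 1 * F)" "j < dim_col (Q 1 * F)"
    then have ij: "i \<le> n" "j \<le> n" using F by (auto simp: Q_def)
    have "(M * Q 1) $$ (i, j) = (\<Sum>l\<le>n. M $$ (i, l) * (if l = j then 1 else if j = 0 then 1 else 0))"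
      using M ij by (simp add: Q_def scalar_prod_def atLeast0LessThan lessThan_Suc_atMost)
    also have "\<dots> = (if j = 0 then 0 else M $$ (i, j))"
    proof (cases "j = 0")
      case True
      have "(\<Sum>l\<le>n. M $$ (i, l) * (if l = j then 1 else if j = 0 then 1 else 0)) = (\<Sum>l\<le>n. M $$ (i, l))"
        using True by (intro sum.cong) auto
      then show ?thesis using True row[OF ij(1)] by simp
    next
      case False
      have "(\<Sum>l\<le>n. M $$ (i, l) * (if l = j then 1 else if j = 0 then 1 else 0))
          = (\<Sum>l\<le>n. if l = j then M $$ (i, l) else 0)"
        using False by (intro sum.cong) auto
      then show ?thesis using False ij by simp
    qed
    also have "\<dots> = (Q 1 * F) $$ (i, j)"
      unfolding QX[OF F ij] using ij by (auto simp: Fij)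
    finally show "(M * Q 1) $$ (i, j) = (Q 1 * F) $$ (i, j)" .
  qed (use M F in \<open>auto simp: Q_def\<close>)
  have "M = M * (Q 1 * Q (- 1))" unfolding QQ by (rule right_mult_one_mat[OF M, symmetric])
  also have "\<dots> = Q 1 * F * Q (- 1)"
    unfolding MQ[symmetric] by (rule assoc_mult_mat[OF M Q Q, symmetric])
  finally have "similar_mat_wit M F (Q 1) (Q (- 1))"
    by (rule similar_mat_witI[OF QQ QQ[of "- 1", unfolded minus_minus] _ M F Q Q])
  then have "char_poly M = char_poly F" by (intro char_poly_similar) (unfold similar_mat_def, blast)
  also have "\<dots> = char_poly (0\<^sub>m 1 1) * char_poly (deflate n M)"
    unfolding F_def by (rule char_poly_four_block_zeros_col[OF _ _ D]) auto
  also have "char_poly (0\<^sub>m 1 1 :: 'a mat) = [:0, 1:]"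
    by (subst char_poly_upper_triangular[of _ 1]) (auto simp: upper_triangular_def diag_mat_def)
  finally show ?thesis .
qed

text \<open>
  If also the columns of \<open>M\<close> sum to zero, every eigenvector of the quotient lifts to an eigenvector
  with zero sum. A lift \<open>u\<close> satisfies \<open>M u = \<kappa> u + \<rho> 1\<close>; summing all components
  gives \<open>0 = \<kappa> \<Sum>u + (n + 1) \<rho>\<close>, so subtracting the mean of \<open>u\<close> removes the error term, also
  for \<open>\<kappa> = 0\<close>.
\<close>
lemma deflate_eigenvalue_iff:
  fixes M :: "'a :: field_char_0 mat"
  assumes M: "M \<in> carrier_mat (Suc n) (Suc n)"
    and row: "\<And>i. i \<le> n \<Longrightarrow> (\<Sum>j\<le>n. M $$ (i, j)) = 0"
    and col: "\<And>j. j \<le> n \<Longrightarrow> (\<Sum>i\<le>n. M $$ (i, j)) = 0"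
  shows "poly (char_poly (deflate n M)) \<kappa> = 0 \<longleftrightarrow>
    (\<exists>w \<in> carrier_vec (Suc n). w \<noteq> 0\<^sub>v (Suc n) \<and> (\<Sum>i\<le>n. w $ i) = 0 \<and> M *\<^sub>v w = \<kappa> \<cdot>\<^sub>v w)"
proof -
  have D: "deflate n M \<in> carrier_mat n n" by (simp add: deflate_def)
  have Mw: "(M *\<^sub>v w) $ i = (\<Sum>j\<le>n. M $$ (i, j) * (w $ j - s))" if "w \<in> carrier_vec (Suc n)" "i \<le> n" for w i s
    using that M row[of i]
    by (simp add: scalar_prod_def atLeast0LessThan lessThan_Suc_atMost right_diff_distrib sum_subtractf
        sum_distrib_right[symmetric])
  have Dy: "(deflate n M *\<^sub>v vec n (\<lambda>i. w $ Suc i - w $ 0)) $ i = (M *\<^sub>v w) $ Suc i - (M *\<^sub>v w) $ 0"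
    if w: "w \<in> carrier_vec (Suc n)" and i: "i < n" for w i
  proof -
    have "(M *\<^sub>v w) $ Suc i - (M *\<^sub>v w) $ 0 = (\<Sum>j\<le>n. (M $$ (Suc i, j) - M $$ (0, j)) * (w $ j - w $ 0))"
      using i Mw[OF w, of "Suc i" "w $ 0"] Mw[OF w, of 0 "w $ 0"]
      by (simp add: sum_subtractf left_diff_distrib del: index_mult_mat_vec)
    also have "\<dots> = (\<Sum>j<n. (M $$ (Suc i, Suc j) - M $$ (0, Suc j)) * (w $ Suc j - w $ 0))"
      unfolding lessThan_Suc_atMost[symmetric] sum.lessThan_Suc_shift by simp
    also have "\<dots> = (deflate n M *\<^sub>v vec n (\<lambda>i. w $ Suc i - w $ 0)) $ i"
      using i by (simp add: deflate_def scalar_prod_def atLeast0LessThan)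
    finally show ?thesis by simp
  qed
  show ?thesis
  proof
    assume "poly (char_poly (deflate n M)) \<kappa> = 0"
    then have "eigenvalue (deflate n M) \<kappa>" using eigenvalue_root_char_poly[OF D] by simp
    then obtain y where y: "y \<in> carrier_vec n" "y \<noteq> 0\<^sub>v n" "deflate n M *\<^sub>v y = \<kappa> \<cdot>\<^sub>v y"
      using D by (auto simp: eigenvalue_def eigenvector_def deflate_def)
    define u where "u = vec (Suc n) (\<lambda>i. if i = 0 then 0 else y $ (i - 1))"
    define s where "s = (\<Sum>i\<le>n. u $ i) / of_nat (Suc n)"
    have ns: "of_nat (Suc n) * s = (\<Sum>i\<le>n. u $ i)" unfolding s_def by (simp del: of_nat_Suc)
    define w where "w = vec (Suc n) (\<lambda>i. u $ i - s)"
    have u: "u \<in> carrier_vec (Suc n)" and w: "w \<in> carrier_vec (Suc n)" by (simp_all add: u_def w_def)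
    have yu: "y = vec n (\<lambda>i. u $ Suc i - u $ 0)" using y(1) by (intro eq_vecI) (auto simp: u_def)
    define \<rho> where "\<rho> = (M *\<^sub>v u) $ 0"
    have Mu: "(M *\<^sub>v u) $ i = \<kappa> * u $ i + \<rho>" if i: "i \<le> n" for i
    proof (cases i)
      case 0
      then show ?thesis by (simp add: \<rho>_def u_def)
    next
      case (Suc l)
      then have l: "l < n" using i by simp
      have "(M *\<^sub>v u) $ Suc l - (M *\<^sub>v u) $ 0 = (deflate n M *\<^sub>v y) $ l"
        unfolding yu by (rule Dy[OF u l, symmetric])
      also have "\<dots> = \<kappa> * y $ l" unfolding y(3) using y(1) l by simp
      finally have "(M *\<^sub>v u) $ Suc l - (M *\<^sub>v u) $ 0 = \<kappa> * y $ l" .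
      moreover have "y $ l = u $ Suc l" using l by (simp add: u_def)
      ultimately show ?thesis by (simp add: Suc \<rho>_def diff_eq_eq del: index_mult_mat_vec)
    qed
    have "(\<Sum>i\<le>n. (M *\<^sub>v u) $ i) = (\<Sum>i\<le>n. \<Sum>j\<le>n. M $$ (i, j) * u $ j)"
      using Mw[OF u, of _ 0] by (intro sum.cong) (auto simp del: index_mult_mat_vec)
    also have "\<dots> = (\<Sum>j\<le>n. (\<Sum>i\<le>n. M $$ (i, j)) * u $ j)"
      by (subst sum.swap) (simp add: sum_distrib_right)
    also have "\<dots> = 0" using col by simp
    also have "(\<Sum>i\<le>n. (M *\<^sub>v u) $ i) = (\<Sum>i\<le>n. \<kappa> * u $ i + \<rho>)"
      using Mu by (intro sum.cong) auto
    finally have "\<kappa> * (\<Sum>i\<le>n. u $ i) + of_nat (Suc n) * \<rho> = 0"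
      by (simp add: sum.distrib sum_distrib_left)
    then have "\<kappa> * (of_nat (Suc n) * s) + of_nat (Suc n) * \<rho> = 0" unfolding ns .
    then have "of_nat (Suc n) * (\<kappa> * s + \<rho>) = 0" by (simp only: distrib_left mult.left_commute)
    then have "\<kappa> * s + \<rho> = 0" by (metis mult_eq_0_iff of_nat_neq_0)
    then have \<rho>: "- (\<kappa> * s) = \<rho>" by (rule minus_unique)
    have "M *\<^sub>v w = \<kappa> \<cdot>\<^sub>v w"
    proof (rule eq_vecI)
      fix i assume "i < dim_vec (\<kappa> \<cdot>\<^sub>v w)"
      then have i: "i \<le> n" using w by simp
      have "(M *\<^sub>v w) $ i = (\<Sum>j\<le>n. M $$ (i, j) * (w $ j - (- s)))" by (rule Mw[OF w i])
      also have "\<dots> = (\<Sum>j\<le>n. M $$ (i, j) * (u $ j - 0))" by (intro sum.cong) (auto simp: w_def)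
      also have "\<dots> = (M *\<^sub>v u) $ i" by (rule Mw[OF u i, symmetric])
      also have "\<dots> = (\<kappa> \<cdot>\<^sub>v w) $ i" using i Mu[OF i] by (simp add: w_def right_diff_distrib \<rho>[symmetric] del: index_mult_mat_vec)
      finally show "(M *\<^sub>v w) $ i = (\<kappa> \<cdot>\<^sub>v w) $ i" .
    qed (use M w in auto)
    moreover have "(\<Sum>i\<le>n. w $ i) = 0"
    proof -
      have "(\<Sum>i\<le>n. w $ i) = (\<Sum>i\<le>n. u $ i) - of_nat (Suc n) * s"
        by (simp add: w_def sum_subtractf)
      then show ?thesis unfolding ns by simp
    qed
    moreover have "w \<noteq> 0\<^sub>v (Suc n)"
    proof
      assume w0: "w = 0\<^sub>v (Suc n)"
      have "y $ i = 0" if "i < n" for i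
      proof -
        have "w $ Suc i = 0" "w $ 0 = 0" unfolding w0 using that by auto
        then show ?thesis using that by (simp add: w_def u_def)
      qed
      then have "y = 0\<^sub>v n" using y(1) by (intro eq_vecI) auto
      with y(2) show False ..
    qed
    ultimately show "\<exists>w \<in> carrier_vec (Suc n). w \<noteq> 0\<^sub>v (Suc n) \<and> (\<Sum>i\<le>n. w $ i) = 0 \<and> M *\<^sub>v w = \<kappa> \<cdot>\<^sub>v w"
      using w by blast
  next
    assume "\<exists>w \<in> carrier_vec (Suc n). w \<noteq> 0\<^sub>v (Suc n) \<and> (\<Sum>i\<le>n. w $ i) = 0 \<and> M *\<^sub>v w = \<kappa> \<cdot>\<^sub>v w"
    then obtain w where w: "w \<in> carrier_vec (Suc n)" "w \<noteq> 0\<^sub>v (Suc n)" "(\<Sum>i\<le>n. w $ i) = 0"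
      "M *\<^sub>v w = \<kappa> \<cdot>\<^sub>v w" by blast
    define y where "y = vec n (\<lambda>i. w $ Suc i - w $ 0)"
    have "y \<noteq> 0\<^sub>v n"
    proof
      assume y0: "y = 0\<^sub>v n"
      have eq: "w $ i = w $ 0" if "i \<le> n" for i
      proof (cases i)
        case (Suc l)
        then have "y $ l = w $ i - w $ 0" using that by (simp add: y_def)
        then show ?thesis using that Suc by (simp add: y0)
      qed simp
      have "(\<Sum>i\<le>n. w $ i) = (\<Sum>i\<le>n. w $ 0)" by (intro sum.cong refl eq) simp
      then have "of_nat (Suc n) * w $ 0 = 0" using w(3) by simp
      then have "w $ 0 = 0" by (simp del: of_nat_Suc)
      then have "w $ i = 0" if "i \<le> n" for i using eq[OF that] by simp
      then have "w = 0\<^sub>v (Suc n)" using w(1) by (intro eq_vecI) auto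
      with w(2) show False ..
    qed
    moreover have "deflate n M *\<^sub>v y = \<kappa> \<cdot>\<^sub>v y"
    proof (rule eq_vecI)
      fix i assume "i < dim_vec (\<kappa> \<cdot>\<^sub>v y)"
      then have i: "i < n" by (simp add: y_def)
      show "(deflate n M *\<^sub>v y) $ i = (\<kappa> \<cdot>\<^sub>v y) $ i"
        unfolding y_def Dy[OF w(1) i] w(4) using i w(1) by (simp add: algebra_simps)
    qed (use D in \<open>simp add: y_def\<close>)
    moreover have "y \<in> carrier_vec n" by (simp add: y_def)
    ultimately have "eigenvalue (deflate n M) \<kappa>"
      using D by (auto simp: eigenvalue_def eigenvector_def intro!: exI[of _ y])
    then show "poly (char_poly (deflate n M)) \<kappa> = 0" using eigenvalue_root_char_poly[OF D] by simp
  qed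
qed

lemma prod_list_map_remove1:
  fixes f :: "'a \<Rightarrow> 'b :: comm_monoid_mult"
  shows "x \<in> set xs \<Longrightarrow> prod_list (map f xs) = f x * prod_list (map f (remove1 x xs))"
  by (induction xs) (auto simp: mult.left_commute)

lemma eigenvalues_by_Re:
  assumes A: "A \<in> carrier_mat n n"
  shows "char_poly A = (\<Prod>e\<leftarrow>eigenvalues_by_Re A. [:- e, 1:])" "sorted (map Re (eigenvalues_by_Re A))"
    "length (eigenvalues_by_Re A) = n"
proof -
  obtain as where as: "char_poly A = (\<Prod>a\<leftarrow>as. [:- a, 1:])"
    using char_poly_factorized[OF A] by blast
  have "(\<Prod>e\<leftarrow>sort_key Re as. [:- e, 1:]) = (\<Prod>a\<leftarrow>as. [:- a, 1:])"
    by (simp flip: prod_mset_prod_list)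
  then have "\<exists>es. char_poly A = (\<Prod>e\<leftarrow>es. [:- e, 1:]) \<and> sorted (map Re es)"
    using as by (intro exI[of _ "sort_key Re as"]) simp
  then have es: "char_poly A = (\<Prod>e\<leftarrow>eigenvalues_by_Re A. [:- e, 1:]) \<and> sorted (map Re (eigenvalues_by_Re A))"
    unfolding eigenvalues_by_Re_def by (rule someI_ex)
  then show "char_poly A = (\<Prod>e\<leftarrow>eigenvalues_by_Re A. [:- e, 1:])" "sorted (map Re (eigenvalues_by_Re A))"
    by auto
  have "degree (char_poly A) = n" using degree_monic_char_poly[OF A] by simp
  then show "length (eigenvalues_by_Re A) = n"
    using es degree_linear_factors[of uminus "eigenvalues_by_Re A"] by simp
qed

text \<open>
  The factor \<open>X\<close> accounts for one eigenvalue \<open>0\<close>, which has the least possible real part. If the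
  second eigenvalue has positive real part, the first one must be this \<open>0\<close>, and the others are the
  roots of \<open>p\<close>.
\<close>
lemma second_eigenvalue_Re_pos_iff:
  assumes A: "A \<in> carrier_mat n n" and n: "n \<ge> 2"
    and factor: "char_poly A = [:0, 1:] * p"
    and nonneg: "\<And>\<kappa>. poly (char_poly A) \<kappa> = 0 \<Longrightarrow> 0 \<le> Re \<kappa>"
  shows "Re (nth_eigenvalue 2 A) > 0 \<longleftrightarrow> (\<forall>\<kappa>. poly p \<kappa> = 0 \<longrightarrow> Re \<kappa> > 0)"
proof -
  define es where "es = eigenvalues_by_Re A"
  have es: "char_poly A = (\<Prod>e\<leftarrow>es. [:- e, 1:])" "sorted (map Re es)" "length es = n"
    unfolding es_def by (rule eigenvalues_by_Re[OF A])+
  have roots: "poly (\<Prod>e\<leftarrow>xs. [:- e, 1:]) z = 0 \<longleftrightarrow> z \<in> set xs" for xs and z :: complex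
    by (induction xs) auto
  have "poly (char_poly A) 0 = 0" by (simp add: factor)
  then have 0: "0 \<in> set es" by (simp add: es(1) roots)
  have "[:0, 1:] * p = [:0, 1:] * (\<Prod>e\<leftarrow>remove1 0 es. [:- e, 1:])"
    using prod_list_map_remove1[OF 0, of "\<lambda>e. [:- e, 1:]"] factor es(1) by simp
  then have p: "p = (\<Prod>e\<leftarrow>remove1 0 es. [:- e, 1:])" by (subst (asm) mult_left_cancel) auto
  obtain e1 e2 rest where e: "es = e1 # e2 # rest"
    using es(3) n by (metis One_nat_def Suc_1 Suc_le_length_iff)
  have nth: "nth_eigenvalue 2 A = e2" by (simp add: nth_eigenvalue_def es_def[symmetric] e)
  have nn: "0 \<le> Re z" if "z \<in> set es" for z using nonneg[of z] that by (simp add: es(1) roots)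
  have le: "Re e1 \<le> Re e2" "\<And>z. z \<in> set rest \<Longrightarrow> Re e2 \<le> Re z" using es(2) by (auto simp: e)
  have pr: "poly p z = 0 \<longleftrightarrow> z \<in> set (remove1 0 es)" for z unfolding p by (rule roots)
  show ?thesis
  proof
    assume "Re (nth_eigenvalue 2 A) > 0"
    then have e2: "Re e2 > 0" by (simp add: nth)
    then have tail: "0 < Re z" if "z \<in> set (e2 # rest)" for z using that le(2)[of z] by auto
    then have "0 \<notin> set (e2 # rest)" by force
    then have "e1 = 0" using 0 by (simp add: e)
    then show "\<forall>\<kappa>. poly p \<kappa> = 0 \<longrightarrow> Re \<kappa> > 0" using tail by (auto simp: pr e)
  next
    assume pos: "\<forall>\<kappa>. poly p \<kappa> = 0 \<longrightarrow> Re \<kappa> > 0"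
    show "Re (nth_eigenvalue 2 A) > 0"
    proof (cases "e1 = 0")
      case True
      then show ?thesis using pos by (simp add: pr e nth)
    next
      case False
      then have "Re e1 > 0" using pos by (simp add: pr e)
      then show ?thesis using le(1) by (simp add: nth)
    qed
  qed
qed

section \<open>The spectrum of \<open>\<Lambda>\<close>\<close>

context coupled_oscillators
begin

definition \<Lambda> :: "complex mat" where "\<Lambda> = Lambda_mat q m0 k0 m b k"

lemma \<Lambda>_carrier [simp]: "\<Lambda> \<in> carrier_mat q q"
  and \<Lambda>_entry: "i < q \<Longrightarrow> j < q \<Longrightarrow>
    \<Lambda> $$ (i, j) = Complex (P $$ (i, j)) (H $$ (i, j) - (if i = j then k0 / m0 else 0))"
proof -
  let ?c = "map_mat complex_of_real"
  have c: "?c X \<in> carrier_mat q q" if "X \<in> carrier_mat q q" for X using that by simp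
  have hom: "?c (R * (X * R)) = ?c R * (?c X * ?c R)" if X: "X \<in> carrier_mat q q" for X
  proof -
    have "?c (X * R) = ?c X * ?c R" by (rule of_real_hom.mat_hom_mult[OF X carriers(5)])
    then show ?thesis
      using of_real_hom.mat_hom_mult[OF carriers(5) mult_carrier_mat[OF X carriers(5)], where ?'a = complex] by simp
  qed
  note [simp del] = assoc_mult_mat
  have "?c R * (?c B + \<i> \<cdot>\<^sub>m ?c L) * ?c R = ?c R * ((?c B + \<i> \<cdot>\<^sub>m ?c L) * ?c R)"
    by (rule assoc_mult_mat[of _ q q _ q _ q]) simp_all
  also have "(?c B + \<i> \<cdot>\<^sub>m ?c L) * ?c R = ?c B * ?c R + \<i> \<cdot>\<^sub>m (?c L * ?c R)"
    by (subst add_mult_distrib_mat[of _ q q _ _ q]) (simp_all add: mult_smult_assoc_mat[of _ q q _ q])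
  also have "?c R * (?c B * ?c R + \<i> \<cdot>\<^sub>m (?c L * ?c R))
      = ?c R * (?c B * ?c R) + \<i> \<cdot>\<^sub>m (?c R * (?c L * ?c R))"
    by (subst mult_add_distrib_mat[of _ q q _ q])
       (auto intro!: mult_carrier_mat[of _ q q] simp: mult_smult_distrib[of _ q q _ q])
  also have "\<dots> = ?c P + \<i> \<cdot>\<^sub>m ?c H"
    unfolding P_def H_def hom[OF carriers(2)] hom[OF carriers(3)] ..
  finally have \<Lambda>: "\<Lambda> = ?c P + \<i> \<cdot>\<^sub>m ?c H - (\<i> * complex_of_real (k0 / m0)) \<cdot>\<^sub>m 1\<^sub>m q"
    unfolding \<Lambda>_def Lambda_mat_def Let_def N_def[symmetric] L_def[symmetric] B_def[symmetric] R_def[symmetric]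
    by simp
  show "\<Lambda> \<in> carrier_mat q q"
    unfolding \<Lambda> by (intro minus_carrier_mat smult_carrier_mat one_carrier_mat)
  show "\<Lambda> $$ (i, j) = Complex (P $$ (i, j)) (H $$ (i, j) - (if i = j then k0 / m0 else 0))"
    if "i < q" "j < q" for i j
    unfolding \<Lambda> using that by (simp add: complex_eq_iff)
qed

lemma \<Lambda>_mult_vec:
  assumes w: "w \<in> carrier_vec q" and i: "i < q"
  shows "Re ((\<Lambda> *\<^sub>v w) $ i) = (P *\<^sub>v map_vec Re w) $ i - (H *\<^sub>v map_vec Im w) $ i + k0 / m0 * Im (w $ i)"
    and "Im ((\<Lambda> *\<^sub>v w) $ i) = (P *\<^sub>v map_vec Im w) $ i + (H *\<^sub>v map_vec Re w) $ i - k0 / m0 * Re (w $ i)"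
proof -
  have \<Lambda>w: "(\<Lambda> *\<^sub>v w) $ i = (\<Sum>j<q. \<Lambda> $$ (i, j) * w $ j)"
    using w i carrier_matD[OF \<Lambda>_carrier] by (simp add: scalar_prod_def atLeast0LessThan)
  have real: "(X *\<^sub>v map_vec f w) $ i = (\<Sum>j<q. X $$ (i, j) * f (w $ j))"
    if "X \<in> carrier_mat q q" for X :: "real mat" and f
    using that w i by (simp add: scalar_prod_def atLeast0LessThan)
  have shift: "(\<Sum>j<q. (H $$ (i, j) - (if i = j then k0 / m0 else 0)) * f (w $ j))
      = (\<Sum>j<q. H $$ (i, j) * f (w $ j)) - k0 / m0 * f (w $ i)" for f :: "complex \<Rightarrow> real"
  proof -
    have "(\<Sum>j<q. (H $$ (i, j) - (if i = j then k0 / m0 else 0)) * f (w $ j))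
      = (\<Sum>j<q. H $$ (i, j) * f (w $ j) - (if j = i then k0 / m0 * f (w $ i) else 0))"
      by (intro sum.cong) (auto simp: left_diff_distrib)
    then show ?thesis using i by (simp add: sum_subtractf)
  qed
  have "Re ((\<Lambda> *\<^sub>v w) $ i) = (\<Sum>j<q. P $$ (i, j) * Re (w $ j)
      - (H $$ (i, j) - (if i = j then k0 / m0 else 0)) * Im (w $ j))"
    unfolding \<Lambda>w Re_sum using i by (intro sum.cong) (simp_all add: \<Lambda>_entry)
  then show "Re ((\<Lambda> *\<^sub>v w) $ i) = (P *\<^sub>v map_vec Re w) $ i - (H *\<^sub>v map_vec Im w) $ i + k0 / m0 * Im (w $ i)"
    unfolding real[OF carriers(6)] real[OF carriers(7)] sum_subtractf shift by simp
  have "Im ((\<Lambda> *\<^sub>v w) $ i) = (\<Sum>j<q. P $$ (i, j) * Im (w $ j)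
      + (H $$ (i, j) - (if i = j then k0 / m0 else 0)) * Re (w $ j))"
    unfolding \<Lambda>w Im_sum using i by (intro sum.cong) (simp_all add: \<Lambda>_entry)
  then show "Im ((\<Lambda> *\<^sub>v w) $ i) = (P *\<^sub>v map_vec Im w) $ i + (H *\<^sub>v map_vec Re w) $ i - k0 / m0 * Re (w $ i)"
    unfolding real[OF carriers(6)] real[OF carriers(7)] sum.distrib shift by simp
qed

lemma \<Lambda>_eigenvector_parts:
  assumes w: "w \<in> carrier_vec q" and eig: "\<Lambda> *\<^sub>v w = z \<cdot>\<^sub>v w"
  defines "x \<equiv> map_vec Re w" and "y \<equiv> map_vec Im w"
  shows "P *\<^sub>v x - H *\<^sub>v y = Re z \<cdot>\<^sub>v x - (Im z + k0 / m0) \<cdot>\<^sub>v y"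
    and "P *\<^sub>v y + H *\<^sub>v x = Re z \<cdot>\<^sub>v y + (Im z + k0 / m0) \<cdot>\<^sub>v x"
proof -
  have xy: "x \<in> carrier_vec q" "y \<in> carrier_vec q" using w by (simp_all add: x_def y_def)
  show "P *\<^sub>v x - H *\<^sub>v y = Re z \<cdot>\<^sub>v x - (Im z + k0 / m0) \<cdot>\<^sub>v y"
  proof (rule eq_vecI)
    fix i assume "i < dim_vec (Re z \<cdot>\<^sub>v x - (Im z + k0 / m0) \<cdot>\<^sub>v y)"
    then have i: "i < q" using xy by simp
    have "Re ((\<Lambda> *\<^sub>v w) $ i) = Re z * x $ i - Im z * y $ i" unfolding eig using w i by (simp add: x_def y_def)
    then show "(P *\<^sub>v x - H *\<^sub>v y) $ i = (Re z \<cdot>\<^sub>v x - (Im z + k0 / m0) \<cdot>\<^sub>v y) $ i"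
      using \<Lambda>_mult_vec(1)[OF w i] i w unfolding x_def y_def
      by (simp add: distrib_right del: index_mult_mat_vec)
  qed (use xy in simp)
  show "P *\<^sub>v y + H *\<^sub>v x = Re z \<cdot>\<^sub>v y + (Im z + k0 / m0) \<cdot>\<^sub>v x"
  proof (rule eq_vecI)
    fix i assume "i < dim_vec (Re z \<cdot>\<^sub>v y + (Im z + k0 / m0) \<cdot>\<^sub>v x)"
    then have i: "i < q" using xy by simp
    have "Im ((\<Lambda> *\<^sub>v w) $ i) = Re z * y $ i + Im z * x $ i" unfolding eig using w i by (simp add: x_def y_def)
    then show "(P *\<^sub>v y + H *\<^sub>v x) $ i = (Re z \<cdot>\<^sub>v y + (Im z + k0 / m0) \<cdot>\<^sub>v x) $ i"
      using \<Lambda>_mult_vec(2)[OF w i] i w unfolding x_def y_def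
      by (simp add: distrib_right del: index_mult_mat_vec)
  qed (use xy in simp)
qed

text \<open>
  Pair the two parts of the eigenvalue equation with \<open>x\<close> and \<open>y\<close> and add: the terms with \<open>H\<close> and
  those with \<open>Im z\<close> cancel by symmetry.
\<close>
lemma \<Lambda>_eigenvalue_Re:
  assumes w: "w \<in> carrier_vec q" and eig: "\<Lambda> *\<^sub>v w = z \<cdot>\<^sub>v w"
  defines "x \<equiv> map_vec Re w" and "y \<equiv> map_vec Im w"
  shows "Re z * (x \<bullet> x + y \<bullet> y) = x \<bullet> (P *\<^sub>v x) + y \<bullet> (P *\<^sub>v y)"
proof -
  have xy [simp]: "x \<in> carrier_vec q" "y \<in> carrier_vec q" using w by (simp_all add: x_def y_def)
  note parts = \<Lambda>_eigenvector_parts[OF w eig, folded x_def y_def]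
  have "x \<bullet> (P *\<^sub>v x) - x \<bullet> (H *\<^sub>v y) = Re z * (x \<bullet> x) - (Im z + k0 / m0) * (x \<bullet> y)"
    using arg_cong[OF parts(1), of "\<lambda>v. x \<bullet> v"] by (simp add: scalar_prod_minus_distrib[of _ q] scalar_prod_smult_distrib[of _ q])
  moreover have "y \<bullet> (P *\<^sub>v y) + y \<bullet> (H *\<^sub>v x) = Re z * (y \<bullet> y) + (Im z + k0 / m0) * (y \<bullet> x)"
    using arg_cong[OF parts(2), of "\<lambda>v. y \<bullet> v"] by (simp add: scalar_prod_add_distrib[of _ q] scalar_prod_smult_distrib[of _ q])
  moreover have "x \<bullet> (H *\<^sub>v y) = y \<bullet> (H *\<^sub>v x)"
    using adjoint[OF carriers(7) symmetric(7) xy] comm_scalar_prod[of "H *\<^sub>v x" q y] by simp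
  moreover have "y \<bullet> x = x \<bullet> y" by (rule comm_scalar_prod[OF xy(2,1)])
  ultimately show ?thesis by (simp add: distrib_left)
qed

lemma Re_Im_vec_nonzero:
  assumes w: "w \<in> carrier_vec q" "w \<noteq> 0\<^sub>v q"
  shows "map_vec Re w \<noteq> 0\<^sub>v q \<or> map_vec Im w \<noteq> 0\<^sub>v q"
proof (rule ccontr)
  assume "\<not> ?thesis"
  then have zero: "map_vec Re w = 0\<^sub>v q" "map_vec Im w = 0\<^sub>v q" by auto
  have "w $ i = 0" if "i < q" for i
    using arg_cong[OF zero(1), of "\<lambda>v. v $ i"] arg_cong[OF zero(2), of "\<lambda>v. v $ i"] that w(1)
    by (simp add: complex_eq_iff)
  then have "w = 0\<^sub>v q" using w(1) by (intro eq_vecI) auto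
  with w(2) show False ..
qed

lemma \<Lambda>_eigenvalue_Re_nonneg:
  assumes w: "w \<in> carrier_vec q" "w \<noteq> 0\<^sub>v q" and eig: "\<Lambda> *\<^sub>v w = z \<cdot>\<^sub>v w"
  shows "0 \<le> Re z"
proof -
  let ?x = "map_vec Re w" and ?y = "map_vec Im w"
  have xy: "?x \<in> carrier_vec q" "?y \<in> carrier_vec q" using w by simp_all
  have "0 < ?x \<bullet> ?x + ?y \<bullet> ?y"
    using Re_Im_vec_nonzero[OF w] scalar_prod_self_pos[OF xy(1)] scalar_prod_self_pos[OF xy(2)]
      scalar_prod_self_nonneg[of ?x] scalar_prod_self_nonneg[of ?y] by linarith
  moreover have "0 \<le> Re z * (?x \<bullet> ?x + ?y \<bullet> ?y)"
    unfolding \<Lambda>_eigenvalue_Re[OF w(1) eig] using P_nonneg[OF xy(1)] P_nonneg[OF xy(2)] by simp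
  ultimately show ?thesis by (simp add: zero_le_mult_iff)
qed

text \<open>
  An undamped mode for \<open>\<mu>\<close> is an eigenvector of \<open>\<Lambda>\<close> for \<open>\<i> (\<mu> - k\<^sub>0/m\<^sub>0)\<close>. Conversely, \<open>Re z = 0\<close>
  makes \<open>x \<bullet> P x\<close> and \<open>y \<bullet> P y\<close> vanish, after which the eigenvalue equation leaves
  \<open>H x = (Im z + k\<^sub>0/m\<^sub>0) x\<close> and the same for \<open>y\<close>.
\<close>
lemma undamped_mode_iff_eigenvalue:
  "(\<exists>w. undamped_mode w) \<longleftrightarrow>
   (\<exists>w z. w \<in> carrier_vec q \<and> w \<noteq> 0\<^sub>v q \<and> (\<Sum>i<q. w $ i) = 0 \<and> \<Lambda> *\<^sub>v w = z \<cdot>\<^sub>v w \<and> Re z = 0)"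
  (is "?L \<longleftrightarrow> ?R")
proof
  assume ?L
  then obtain w \<mu> where w: "w \<in> carrier_vec q" "w \<noteq> 0\<^sub>v q" "ones \<bullet> w = 0" "P *\<^sub>v w = 0\<^sub>v q" "H *\<^sub>v w = \<mu> \<cdot>\<^sub>v w"
    by (auto simp: undamped_mode_def)
  define v where "v = map_vec complex_of_real w"
  have v: "v \<in> carrier_vec q" using w by (simp add: v_def)
  have Re: "map_vec Re v = w" and Im: "map_vec Im v = 0\<^sub>v q" using w(1) by (auto simp: v_def)
  have X0: "X *\<^sub>v 0\<^sub>v q = 0\<^sub>v q" if "X \<in> carrier_mat q q" for X :: "real mat" using that by auto
  have "\<Lambda> *\<^sub>v v = Complex 0 (\<mu> - k0 / m0) \<cdot>\<^sub>v v"
  proof (rule eq_vecI)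
    fix i assume "i < dim_vec (Complex 0 (\<mu> - k0 / m0) \<cdot>\<^sub>v v)"
    then have i: "i < q" using v by simp
    have vi: "v $ i = of_real (w $ i)" using i w(1) by (simp add: v_def)
    have "Re ((\<Lambda> *\<^sub>v v) $ i) = 0"
      unfolding \<Lambda>_mult_vec(1)[OF v i] Re Im w(4) X0[OF carriers(7)] vi using i by simp
    moreover have "Im ((\<Lambda> *\<^sub>v v) $ i) = (\<mu> - k0 / m0) * w $ i"
      unfolding \<Lambda>_mult_vec(2)[OF v i] Re Im w(5) X0[OF carriers(6)] vi
      using i w(1) by (simp add: left_diff_distrib)
    moreover have "(Complex 0 (\<mu> - k0 / m0) \<cdot>\<^sub>v v) $ i = Complex 0 ((\<mu> - k0 / m0) * w $ i)"
      using i v vi by (simp add: complex_eq_iff)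
    ultimately show "(\<Lambda> *\<^sub>v v) $ i = (Complex 0 (\<mu> - k0 / m0) \<cdot>\<^sub>v v) $ i"
      by (simp only: complex_eq_iff complex.sel)
  qed (use v carrier_matD[OF \<Lambda>_carrier] in simp)
  moreover have "v \<noteq> 0\<^sub>v q" using Re w(2) by auto
  moreover have "(\<Sum>i<q. v $ i) = 0"
  proof -
    have "(\<Sum>i<q. v $ i) = of_real (\<Sum>i<q. w $ i)" using w(1) by (simp add: v_def)
    also have "(\<Sum>i<q. w $ i) = ones \<bullet> w" unfolding scalar_prod_eq_sum[OF w(1)] by (simp add: ones_def)
    finally show ?thesis using w(3) by simp
  qed
  ultimately show ?R using v by (intro exI[of _ v] exI[of _ "Complex 0 (\<mu> - k0 / m0)"]) simp
next
  assume ?R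
  then obtain w z where w: "w \<in> carrier_vec q" "w \<noteq> 0\<^sub>v q" "(\<Sum>i<q. w $ i) = 0"
    and eig: "\<Lambda> *\<^sub>v w = z \<cdot>\<^sub>v w" and z: "Re z = 0" by blast
  let ?x = "map_vec Re w" and ?y = "map_vec Im w" and ?\<mu> = "Im z + k0 / m0"
  have xy: "?x \<in> carrier_vec q" "?y \<in> carrier_vec q" using w by simp_all
  have "?x \<bullet> (P *\<^sub>v ?x) + ?y \<bullet> (P *\<^sub>v ?y) = 0" using \<Lambda>_eigenvalue_Re[OF w(1) eig] z by simp
  then have "?x \<bullet> (P *\<^sub>v ?x) = 0 \<and> ?y \<bullet> (P *\<^sub>v ?y) = 0"
    using P_nonneg[OF xy(1)] P_nonneg[OF xy(2)] by linarith
  then have Px: "P *\<^sub>v ?x = 0\<^sub>v q" and Py: "P *\<^sub>v ?y = 0\<^sub>v q"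
    using P_form_eq_0[OF xy(1)] P_form_eq_0[OF xy(2)] by auto
  have Hy: "H *\<^sub>v ?y = ?\<mu> \<cdot>\<^sub>v ?y"
  proof (rule eq_vecI)
    fix i assume "i < dim_vec (?\<mu> \<cdot>\<^sub>v ?y)"
    then have i: "i < q" using w by simp
    show "(H *\<^sub>v ?y) $ i = (?\<mu> \<cdot>\<^sub>v ?y) $ i"
      using arg_cong[OF \<Lambda>_eigenvector_parts(1)[OF w(1) eig], of "\<lambda>v. v $ i"] i w(1) z
      unfolding Px by (simp del: index_mult_mat_vec)
  qed (use w in simp)
  have Hx: "H *\<^sub>v ?x = ?\<mu> \<cdot>\<^sub>v ?x"
  proof (rule eq_vecI)
    fix i assume "i < dim_vec (?\<mu> \<cdot>\<^sub>v ?x)"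
    then have i: "i < q" using w by simp
    show "(H *\<^sub>v ?x) $ i = (?\<mu> \<cdot>\<^sub>v ?x) $ i"
      using arg_cong[OF \<Lambda>_eigenvector_parts(2)[OF w(1) eig], of "\<lambda>v. v $ i"] i w(1) z
      unfolding Py by (simp del: index_mult_mat_vec)
  qed (use w in simp)
  have "ones \<bullet> map_vec f w = (\<Sum>i<q. f (w $ i))" for f :: "complex \<Rightarrow> real"
    using w(1) by (simp add: scalar_prod_def atLeast0LessThan ones_def)
  then have "ones \<bullet> ?x = 0" "ones \<bullet> ?y = 0"
    using w(3) by (simp_all flip: Re_sum Im_sum)
  then show ?L
    using Re_Im_vec_nonzero[OF w(1,2)] xy Px Py Hx Hy unfolding undamped_mode_def by blast
qed

lemma \<Lambda>_row_sum: "i < q \<Longrightarrow> (\<Sum>j<q. \<Lambda> $$ (i, j)) = 0"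
  and \<Lambda>_col_sum: "i < q \<Longrightarrow> (\<Sum>j<q. \<Lambda> $$ (j, i)) = 0"
proof -
  show row: "(\<Sum>j<q. \<Lambda> $$ (i, j)) = 0" if i: "i < q" for i
  proof -
    have X: "(X *\<^sub>v ones) $ i = (\<Sum>j<q. X $$ (i, j))" if "X \<in> carrier_mat q q" for X :: "real mat"
      using that i by (simp add: scalar_prod_def atLeast0LessThan ones_def)
    have P0: "(\<Sum>j<q. P $$ (i, j)) = 0" unfolding X[OF carriers(6), symmetric] P_ones using i by simp
    have H0: "(\<Sum>j<q. H $$ (i, j)) = k0 / m0"
      unfolding X[OF carriers(7), symmetric] H_ones using i by (simp add: ones_def)
    have "(\<Sum>j<q. \<Lambda> $$ (i, j)) = (\<Sum>j<q. Complex (P $$ (i, j)) (H $$ (i, j) - (if i = j then k0 / m0 else 0)))"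
      using i by (intro sum.cong) (auto simp: \<Lambda>_entry)
    also have "\<dots> = 0"
      unfolding complex_eq_iff Re_sum Im_sum using P0 H0 i by (simp add: sum_subtractf)
    finally show ?thesis .
  qed
  have sym: "\<Lambda> $$ (j, i) = \<Lambda> $$ (i, j)" if "i < q" "j < q" for i j
  proof -
    have "X $$ (j, i) = X $$ (i, j)" if "X \<in> carrier_mat q q" "transpose_mat X = X" for X :: "real mat"
      using that \<open>i < q\<close> \<open>j < q\<close> by (metis carrier_matD index_transpose_mat(1))
    then show ?thesis using that symmetric(6,7) carriers(6,7) by (simp add: \<Lambda>_entry)
  qed
  show "(\<Sum>j<q. \<Lambda> $$ (j, i)) = 0" if i: "i < q" for i
  proof -
    have "(\<Sum>j<q. \<Lambda> $$ (j, i)) = (\<Sum>j<q. \<Lambda> $$ (i, j))" using i by (intro sum.cong) (auto intro: sym)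
    then show ?thesis using row[OF i] by simp
  qed
qed

text \<open>
  The roots of the deflated characteristic polynomial are the eigenvalues with an eigenvector
  orthogonal to \<open>ones\<close>; none of them has negative real part, and an undamped mode is one with real
  part zero.
\<close>
lemma no_undamped_mode_iff_second_eigenvalue:
  "(\<nexists>w. undamped_mode w) \<longleftrightarrow> Re (nth_eigenvalue 2 \<Lambda>) > 0"
proof -
  define n where "n = q - 1"
  have qn: "q = Suc n" using q2 by (simp add: n_def)
  have rows: "(\<Sum>j\<le>n. \<Lambda> $$ (i, j)) = 0" "(\<Sum>j\<le>n. \<Lambda> $$ (j, i)) = 0" if "i \<le> n" for i
    using \<Lambda>_row_sum[of i] \<Lambda>_col_sum[of i] that by (simp_all add: qn lessThan_Suc_atMost)
  have \<Lambda>n: "\<Lambda> \<in> carrier_mat (Suc n) (Suc n)" using \<Lambda>_carrier unfolding qn .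
  have root_nonneg: "0 \<le> Re z" if "poly (char_poly \<Lambda>) z = 0" for z
  proof -
    have "eigenvalue \<Lambda> z" using that eigenvalue_root_char_poly[OF \<Lambda>_carrier] by simp
    then obtain w where "w \<in> carrier_vec q" "w \<noteq> 0\<^sub>v q" "\<Lambda> *\<^sub>v w = z \<cdot>\<^sub>v w"
      using carrier_matD[OF \<Lambda>_carrier] by (auto simp: eigenvalue_def eigenvector_def)
    then show ?thesis by (rule \<Lambda>_eigenvalue_Re_nonneg)
  qed
  have root: "poly (char_poly (deflate n \<Lambda>)) z = 0 \<longleftrightarrow>
      (\<exists>w \<in> carrier_vec q. w \<noteq> 0\<^sub>v q \<and> (\<Sum>i<q. w $ i) = 0 \<and> \<Lambda> *\<^sub>v w = z \<cdot>\<^sub>v w)" for z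
    using deflate_eigenvalue_iff[OF \<Lambda>n rows, of z]
    by (simp only: qn[symmetric] lessThan_Suc_atMost[symmetric])
  have "Re (nth_eigenvalue 2 \<Lambda>) > 0 \<longleftrightarrow> (\<forall>z. poly (char_poly (deflate n \<Lambda>)) z = 0 \<longrightarrow> Re z > 0)"
    by (rule second_eigenvalue_Re_pos_iff[OF \<Lambda>_carrier q2 char_poly_deflate[OF \<Lambda>n rows(1)] root_nonneg])
  also have "\<dots> \<longleftrightarrow> (\<nexists>w. undamped_mode w)"
    unfolding undamped_mode_iff_eigenvalue root
    using \<Lambda>_eigenvalue_Re_nonneg by (metis less_le)
  finally show ?thesis by blast
qed

end

theorem theorem1:
  fixes q :: nat and m0 k0 :: real and m b k :: "nat \<Rightarrow> nat \<Rightarrow> real"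
  assumes "q \<ge> 2" and "m0 > 0" and "k0 > 0"
    and "coupling_array q m" and "coupling_array q b" and "coupling_array q k"
  shows "oscillators_synchronize q m0 k0 m b k \<longleftrightarrow>
           Re (nth_eigenvalue 2 (Lambda_mat q m0 k0 m b k)) > 0"
proof -
  interpret coupled_oscillators q m0 k0 m b k by unfold_locales (use assms in auto)
  show ?thesis
    using synchronize_iff_no_undamped_mode no_undamped_mode_iff_second_eigenvalue by (simp add: \<Lambda>_def)
qed

end
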